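(* Let $n\ge1$, $\delta>0$, $\beta<n+4$, and let $b\in H^{\sigma}(\mathbf{T}^n)$ with $\sigma\in\mathbb{R}$. For $t\ge0$ let $$U(t)=\hat b_0\frac{t^2}{2}+\sum_{0\ne k\in\mathbb{Z}^n}\frac{\hat b_k}{m_k}\left[\cos(\sqrt{-m_k}\,t)-1\right]e^{ik\cdot x}.$$ Then for any $t\ge0$, $U(t)\in H^s(\mathbf{T}^n)$, where $s=\sigma+\max\{0,\beta-n\}$.
   Context: For $k\in\mathbb{Z}^n$, $m_k=m^{\delta,\beta}(k)$, where for $\nu\in\mathbb{R}^n$ $$m^{\delta,\beta}(\nu)=-\|\nu\|^2\,{}_2F_3\!\left(1,\tfrac{n+2-\beta}{2};2,\tfrac{n+2}{2},\tfrac{n+4-\beta}{2};-\tfrac14\|\nu\|^2\delta^2\right),$$ ${}_2F_3(a_1,a_2;b_1,b_2,b_3;z)=\sum_{j\ge0}\frac{(a_1)_j(a_2)_j}{(b_1)_j(b_2)_j(b_3)_j}\frac{z^j}{j!}$, $(a)_j=a(a+1)\cdots(a+j-1)$. For $\beta<n+4$ one has $m_k<0$ for all $k\neq0$. $\mathbf{T}^n=\prod_{j=1}^n[0,2\pi]$ is the periodic torus; a periodic distribution $g$ is written $g=\sum_{k\in\mathbb{Z}^n}\hat g_ke^{ik\cdot x}$ with Fourier coefficients $\hat g_k$; for $q\in\mathbb{R}$, $H^q(\mathbf{T}^n)$ is the space of periodic distributions with $\|g\|_{H^q(\mathbf{T}^n)}^2=\sum_{k\in\mathbb{Z}^n}(1+\|k\|^2)^q|\hat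 g_k|^2<\infty$. *)

theory Defs
  imports "HOL-Analysis.Analysis"
begin

definition real_vec :: "int ^ 'n \<Rightarrow> real ^ 'n::finite" where
  "real_vec k = (\<chi> i. real_of_int (k $ i))"

definition hyp2F3 :: "real \<Rightarrow> real \<Rightarrow> real \<Rightarrow> real \<Rightarrow> real \<Rightarrow> real \<Rightarrow> real" where
  "hyp2F3 a1 a2 b1 b2 b3 z =
     (\<Sum>j. pochhammer a1 j * pochhammer a2 j /
           (pochhammer b1 j * pochhammer b2 j * pochhammer b3 j) * (z ^ j / fact j))"

definition multiplier :: "real \<Rightarrow> real \<Rightarrow> real ^ 'n::finite \<Rightarrow> real" where
  "multiplier \<delta> \<beta> \<nu> =
     - (norm \<nu>)\<^sup>2 *
       hyp2F3 1 ((real CARD('n) + 2 - \<beta>) / 2)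
              2 ((real CARD('n) + 2) / 2) ((real CARD('n) + 4 - \<beta>) / 2)
              (- (1 / 4) * (norm \<nu>)\<^sup>2 * \<delta>\<^sup>2)"

definition torus :: "(real ^ 'n::finite) set" where
  "torus = cbox 0 (\<chi> i. 2 * pi)"

definition periodic :: "(real ^ 'n::finite \<Rightarrow> complex) \<Rightarrow> bool" where
  "periodic f \<longleftrightarrow> (\<forall>i x. f (x + (2 * pi) *\<^sub>R axis i 1) = f x)"

definition partial :: "'n \<Rightarrow> (real ^ 'n::finite \<Rightarrow> complex) \<Rightarrow> real ^ 'n \<Rightarrow> complex" where
  "partial i f x = vector_derivative (\<lambda>h. f (x + h *\<^sub>R axis i 1)) (at 0)"

definition partials :: "'n list \<Rightarrow> (real ^ 'n::finite \<Rightarrow> complex) \<Rightarrow> real ^ 'n \<Rightarrow> complex" where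
  "partials is f = foldr partial is f"

text \<open>Smoothness: all iterated partial derivatives, of every order and in every sequence of
  directions, exist and are continuous.\<close>

definition smooth :: "(real ^ 'n::finite \<Rightarrow> complex) \<Rightarrow> bool" where
  "smooth f \<longleftrightarrow>
     (\<forall>is. continuous_on UNIV (partials is f) \<and>
           (\<forall>i x. (\<lambda>h. partials is f (x + h *\<^sub>R axis i 1)) differentiable (at 0)))"

definition test_functions :: "(real ^ 'n::finite \<Rightarrow> complex) set" where
  "test_functions = {\<phi>. smooth \<phi> \<and> periodic \<phi>}"

text \<open>The usual defining norms of the Frechet topology on the smooth periodic functions. The
  supremum is over a bounded set, because the derivatives of a test function are continuous and
  periodic and there are finitely many lists of length at most \<open>N\<close>.\<close>

definition test_norm :: "nat \<Rightarrow> (real ^ 'n::finite \<Rightarrow> complex) \<Rightarrow> real" where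
  "test_norm N \<phi> = (SUP (is, x) \<in> {is. length is \<le> N} \<times> UNIV. cmod (partials is \<phi> x))"

text \<open>Only the values on \<^const>\<open>test_functions\<close> matter; those at other arguments are
  unconstrained.\<close>

definition periodic_distribution :: "((real ^ 'n::finite \<Rightarrow> complex) \<Rightarrow> complex) \<Rightarrow> bool" where
  "periodic_distribution g \<longleftrightarrow>
     (\<forall>\<phi>\<in>test_functions. \<forall>\<psi>\<in>test_functions. g (\<lambda>x. \<phi> x + \<psi> x) = g \<phi> + g \<psi>) \<and>
     (\<forall>c. \<forall>\<phi>\<in>test_functions. g (\<lambda>x. c * \<phi> x) = c * g \<phi>) \<and>
     (\<exists>C N. \<forall>\<phi>\<in>test_functions. cmod (g \<phi>) \<le> C * test_norm N \<phi>)"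

definition mode :: "int ^ 'n \<Rightarrow> real ^ 'n::finite \<Rightarrow> complex" where
  "mode k x = exp (\<i> * of_real (real_vec k \<bullet> x))"

text \<open>The distribution given by a locally integrable periodic function; the pairing is bilinear
  (no complex conjugate).\<close>

definition dist_of :: "(real ^ 'n::finite \<Rightarrow> complex) \<Rightarrow> (real ^ 'n \<Rightarrow> complex) \<Rightarrow> complex" where
  "dist_of f \<phi> = integral torus (\<lambda>x. f x * \<phi> x)"

definition fourier_coeff ::
    "((real ^ 'n::finite \<Rightarrow> complex) \<Rightarrow> complex) \<Rightarrow> int ^ 'n \<Rightarrow> complex" where
  "fourier_coeff g k = g (mode (- k)) / of_real ((2 * pi) ^ CARD('n))"

definition sobolev :: "real \<Rightarrow> ((real ^ 'n::finite \<Rightarrow> complex) \<Rightarrow> complex) set" where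
  "sobolev q =
     {g. periodic_distribution g \<and>
         (\<lambda>k. (1 + (norm (real_vec k))\<^sup>2) powr q * (cmod (fourier_coeff g k))\<^sup>2) summable_on UNIV}"

text \<open>The coefficient of the mode \<open>k \<noteq> 0\<close> in the series below.\<close>

definition U_coeff ::
    "real \<Rightarrow> real \<Rightarrow> ((real ^ 'n::finite \<Rightarrow> complex) \<Rightarrow> complex) \<Rightarrow> real \<Rightarrow> int ^ 'n \<Rightarrow> complex" where
  "U_coeff \<delta> \<beta> b t k =
     (let m = multiplier \<delta> \<beta> (real_vec k)
      in fourier_coeff b k / of_real m * of_real (cos (sqrt (- m) * t) - 1))"

text \<open>The series is summed in the sense of distributions, that is, after pairing with a test
  function. Where it diverges \<^const>\<open>infsum\<close> is \<open>0\<close>, so statements about \<open>U\<close> should be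
  accompanied by \<open>U_converges\<close>.\<close>

definition U_converges ::
    "real \<Rightarrow> real \<Rightarrow> ((real ^ 'n::finite \<Rightarrow> complex) \<Rightarrow> complex) \<Rightarrow> real \<Rightarrow> bool" where
  "U_converges \<delta> \<beta> b t \<longleftrightarrow>
     (\<forall>\<phi>\<in>test_functions. (\<lambda>k. U_coeff \<delta> \<beta> b t k * dist_of (mode k) \<phi>) summable_on {k. k \<noteq> 0})"

definition U ::
    "real \<Rightarrow> real \<Rightarrow> ((real ^ 'n::finite \<Rightarrow> complex) \<Rightarrow> complex) \<Rightarrow> real \<Rightarrow>
     (real ^ 'n \<Rightarrow> complex) \<Rightarrow> complex" where
  "U \<delta> \<beta> b t \<phi> =
     fourier_coeff b 0 * of_real (t\<^sup>2 / 2) * dist_of (\<lambda>x. 1) \<phi> +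
     (\<Sum>\<^sub>\<infinity>k\<in>{k. k \<noteq> 0}. U_coeff \<delta> \<beta> b t k * dist_of (mode k) \<phi>)"

end

(* Put \<mu> = n/2 and let \<Phi>(s) = 0F1(; \<mu>; -s). For w = (|\<nu>| \<delta>)^2 / 4 the multiplier is -|\<nu>|^2 F(w),
   where F solves (w^a F)' = a \<mu> w^(a-2) (1 - \<Phi>) and a = (n + 2 - \<beta>) / 2 > -1. The energy
   \<Phi>^2 + s \<Phi>'^2 is nonincreasing, so |\<Phi>| \<le> 1 and |\<Phi>'| \<le> s^(-1/2), whence \<Phi> has mean value 0 on
   [w/2, w] up to o(1); comparing derivatives then gives F(w) \<ge> c w^(-min(1,a))
   for large w, that is |m(\<nu>)| \<ge> c |\<nu>|^max(0, \<beta> - n) for large |\<nu>|. As |cos - 1| \<le> 2, all but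
   finitely many coefficients of U(t) gain the claimed number of derivatives over those of b. Zeros
   of m are harmless because only finitely many modes are left out.
   The series converges as a distribution because integration by parts on the torus makes the
   Fourier coefficients of test functions decay faster than any power. *)

theory Submission
  imports Defs
begin

section \<open>Growth of the multiplier\<close>

text \<open>In dimension n, \<Phi>(s) is the mean of cos(\<nu> . z) over the sphere |z| = r with s =
  (r |\<nu>|)^2 / 4; for a > 0 the multiplier arises from 1 - \<Phi> by radial integration against a
  power, hence the first-order equation for F. Its homogeneous solution is w^(-a), and for a
  \<noteq> 1 the forcing contributes a term of order w^(-1). The slower of the two decides the size
  of F, whence the exponent min(1,a); at a = 1 the true size has an extra logarithm, which the lower
  bound gives away. The danger is that the leading coefficient vanishes. Monotonicity excludes this
  without any asymptotic expansion: for a > 0, 1 - \<Phi> \<ge> 0 makes w^a F nondecreasing, so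
  positivity near w = 0 propagates to infinity. For a < 0 the sign is reversed, and w^a (F - 1) is
  monotone instead, because \<mu> (1 - \<Phi>(s)) \<le> s. Only for a > 1 must w^a F be shown to
  grow, and there the mean value of \<Phi> enters.\<close>

text \<open>For s > 0 this is Gamma(\<mu>) s^((1 - \<mu>)/2) J(2 sqrt s) with J the Bessel function
  of order \<mu> - 1; for \<mu> = 1/2 it is cos(2 sqrt s).\<close>

definition bessel_series :: "real \<Rightarrow> real \<Rightarrow> real" where
  "bessel_series \<mu> s = (\<Sum>j. (-1) ^ j / (fact j * pochhammer \<mu> j) * s ^ j)"

lemma power_le_pochhammer: "0 < \<mu> \<Longrightarrow> \<mu> ^ j \<le> pochhammer \<mu> j" for \<mu> :: real
proof (induction j)
  case (Suc j)
  then have "\<mu> ^ j * \<mu> \<le> pochhammer \<mu> j * (\<mu> + of_nat j)"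
    by (intro mult_mono) (auto intro: pochhammer_nonneg)
  then show ?case by (simp add: pochhammer_Suc mult.commute)
qed simp

text \<open>The majorant is the series of C exp(|s| / \<mu>). Arbitrary coefficients
  \<open>c\<close> let the lemma serve both the Bessel and the 2F3 series.\<close>

lemma summable_over_pochhammer:
  fixes \<mu> s C :: real
  assumes "0 < \<mu>" and "\<And>j. \<bar>c j\<bar> \<le> C / (fact j * pochhammer \<mu> j)"
  shows "summable (\<lambda>j. c j * s ^ j)"
proof (rule summable_comparison_test)
  show "summable (\<lambda>j. C * ((\<bar>s\<bar> / \<mu>) ^ j /\<^sub>R fact j))"
    by (intro summable_mult summable_exp_generic)
  show "\<exists>N. \<forall>j\<ge>N. norm (c j * s ^ j) \<le> C * ((\<bar>s\<bar> / \<mu>) ^ j /\<^sub>R fact j)"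
  proof (intro exI allI impI)
    fix j :: nat
    have "0 \<le> C" using order_trans[OF abs_ge_zero assms(2)[of 0]] by simp
    have "norm (c j * s ^ j) \<le> C / (fact j * pochhammer \<mu> j) * \<bar>s\<bar> ^ j"
      unfolding real_norm_def abs_mult power_abs by (intro mult_right_mono assms) simp
    also have "\<dots> \<le> C / (fact j * \<mu> ^ j) * \<bar>s\<bar> ^ j"
      using power_le_pochhammer[OF assms(1), of j] \<open>0 \<le> C\<close> assms(1)
      by (intro mult_right_mono divide_left_mono mult_left_mono) (auto intro!: mult_pos_pos pochhammer_pos)
    also have "\<dots> = C * ((\<bar>s\<bar> / \<mu>) ^ j /\<^sub>R fact j)"
      by (simp add: power_divide field_simps)
    finally show "norm (c j * s ^ j) \<le> C * ((\<bar>s\<bar> / \<mu>) ^ j /\<^sub>R fact j)" .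
  qed
qed

lemma bessel_series_sums:
  assumes "0 < \<mu>"
  shows "(\<lambda>j. (-1) ^ j / (fact j * pochhammer \<mu> j) * s ^ j) sums bessel_series \<mu> s"
  unfolding bessel_series_def
  using pochhammer_pos[OF assms]
  by (intro summable_sums summable_over_pochhammer[where \<mu> = \<mu> and C = 1])
     (auto simp: assms abs_mult abs_of_pos)

lemma bessel_series_0 [simp]: "bessel_series \<mu> 0 = 1"
  unfolding bessel_series_def by (subst powser_zero) simp

lemma bessel_series_deriv:
  assumes "0 < \<mu>"
  shows "(bessel_series \<mu> has_real_derivative - bessel_series (\<mu> + 1) s / \<mu>) (at s)"
proof -
  define c where "c = (\<lambda>j. (-1) ^ j / (fact j * pochhammer \<mu> j) :: real)"
  have "((\<lambda>x. \<Sum>n. c n * x ^ n) has_real_derivative (\<Sum>n. diffs c n * s ^ n)) (at s)"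
    using bessel_series_sums[OF assms]
    by (intro termdiffs_strong_converges_everywhere) (auto simp: c_def sums_iff)
  moreover have "(\<lambda>x. \<Sum>n. c n * x ^ n) = bessel_series \<mu>"
    by (simp add: c_def bessel_series_def fun_eq_iff)
  moreover have "diffs c n * s ^ n
      = (-1 / \<mu>) * ((-1) ^ n / (fact n * pochhammer (\<mu> + 1) n) * s ^ n)" for n
    using assms by (simp add: c_def diffs_def pochhammer_rec field_simps del: of_nat_Suc)
  then have "(\<Sum>n. diffs c n * s ^ n) = - bessel_series (\<mu> + 1) s / \<mu>"
    using sums_mult[OF bessel_series_sums, of "\<mu> + 1" "-1 / \<mu>" s] assms
    by (simp add: sums_iff)
  ultimately show ?thesis by simp
qed

text \<open>Bessel's equation s \<Phi>'' + \<mu> \<Phi>' + \<Phi> = 0 in disguise: differentiation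
  raises the parameter, so the three series are multiples of \<Phi>'', \<Phi>' and \<Phi>.\<close>

lemma bessel_series_contiguous:
  assumes "0 < \<mu>"
  shows "s / (\<mu> * (\<mu> + 1)) * bessel_series (\<mu> + 2) s
    = bessel_series (\<mu> + 1) s - bessel_series \<mu> s"
proof -
  \<comment> \<open>\<open>f j\<close> is the j-th term of the right-hand side. Its factor j makes
    the term at 0 vanish, and shifting the index by one gives the left-hand side.\<close>
  define f where "f j = - (of_nat j / \<mu>) * ((-1) ^ j / (fact j * pochhammer (\<mu> + 1) j) * s ^ j)" for j
  have "f (Suc j) = s / (\<mu> * (\<mu> + 1)) *
      ((-1) ^ j / (fact j * pochhammer (\<mu> + 2) j) * s ^ j)" for j
    using assms pochhammer_pos[of "\<mu> + 2" j]
    by (simp add: f_def pochhammer_rec[of "\<mu> + 1"] add.assoc del: of_nat_Suc)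
       (simp add: field_simps del: of_nat_Suc)
  then have "(\<lambda>j. f (Suc j)) sums (s / (\<mu> * (\<mu> + 1)) * bessel_series (\<mu> + 2) s)"
    using sums_mult[OF bessel_series_sums[of "\<mu> + 2" s], of "s / (\<mu> * (\<mu> + 1))"] assms
    by (simp only:)
  then have 1: "f sums (s / (\<mu> * (\<mu> + 1)) * bessel_series (\<mu> + 2) s)"
    by (rule sums_Suc_imp[rotated]) (simp add: f_def)
  have "f j = (-1) ^ j / (fact j * pochhammer (\<mu> + 1) j) * s ^ j
      - (-1) ^ j / (fact j * pochhammer \<mu> j) * s ^ j" for j
  proof -
    have "\<mu> * pochhammer (\<mu> + 1) j = pochhammer \<mu> j * (\<mu> + of_nat j)"
      using pochhammer_rec[of \<mu> j] pochhammer_Suc[of \<mu> j] by simp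
    moreover have "0 < \<mu> + real j" using assms by simp
    ultimately have "1 / pochhammer \<mu> j = (\<mu> + of_nat j) / (\<mu> * pochhammer (\<mu> + 1) j)"
      by (simp only:) simp
    moreover have "1 / pochhammer (\<mu> + 1) j - (\<mu> + of_nat j) / (\<mu> * pochhammer (\<mu> + 1) j)
        = - (of_nat j / \<mu>) / pochhammer (\<mu> + 1) j"
      using assms pochhammer_pos[of "\<mu> + 1" j] by (simp add: field_simps)
    ultimately have eq: "- (of_nat j / \<mu>) / pochhammer (\<mu> + 1) j = 1 / pochhammer (\<mu> + 1) j - 1 / pochhammer \<mu> j"
      by simp
    have "f j = ((-1) ^ j * s ^ j / fact j) * (- (of_nat j / \<mu>) / pochhammer (\<mu> + 1) j)"
      by (simp add: f_def mult_ac)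
    then show ?thesis unfolding eq by (simp add: right_diff_distrib)
  qed
  then have "f = (\<lambda>j. (-1) ^ j / (fact j * pochhammer (\<mu> + 1) j) * s ^ j
      - (-1) ^ j / (fact j * pochhammer \<mu> j) * s ^ j)"
    by (rule ext)
  then have "f sums (bessel_series (\<mu> + 1) s - bessel_series \<mu> s)"
    using assms by (simp only:) (intro sums_diff bessel_series_sums, auto)
  with 1 show ?thesis by (rule sums_unique2)
qed

text \<open>By Bessel's equation the left-hand side has derivative (1 - 2 \<mu>) \<Phi>'^2, which is
  \<le> 0 because \<mu> \<ge> 1/2, and its value at 0 is 1. For \<mu> = 1/2 it is cos^2 +
  sin^2.\<close>

lemma bessel_series_energy:
  assumes "1 / 2 \<le> \<mu>" "0 \<le> s"
  shows "(bessel_series \<mu> s)\<^sup>2 + s * (bessel_series (\<mu> + 1) s / \<mu>)\<^sup>2 \<le> 1"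
proof -
  define E where "E s = (bessel_series \<mu> s)\<^sup>2 + s * (bessel_series (\<mu> + 1) s / \<mu>)\<^sup>2" for s
  have \<mu>: "0 < \<mu>" using assms by simp
  have "(E has_real_derivative (1 - 2 * \<mu>) * (bessel_series (\<mu> + 1) s / \<mu>)\<^sup>2) (at s)" for s
  proof -
    define p q r where "p = bessel_series \<mu> s" and "q = bessel_series (\<mu> + 1) s"
      and "r = bessel_series (\<mu> + 2) s"
    have dp: "(bessel_series \<mu> has_real_derivative - q / \<mu>) (at s)"
      unfolding q_def by (rule bessel_series_deriv[OF \<mu>])
    have dq: "((\<lambda>s. bessel_series (\<mu> + 1) s / \<mu>) has_real_derivative - r / (\<mu> + 1) / \<mu>) (at s)"
      unfolding r_def using bessel_series_deriv[of "\<mu> + 1" s] \<mu>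
      by (intro DERIV_cdivide) (simp add: add.assoc)
    have "(E has_real_derivative 2 * p * (- q / \<mu>) + ((q / \<mu>)\<^sup>2 + s * (2 * (q / \<mu>) * (- r / (\<mu> + 1) / \<mu>)))) (at s)"
      unfolding E_def
      using DERIV_add[OF DERIV_power[OF dp, of 2] DERIV_mult[OF DERIV_ident DERIV_power[OF dq, of 2]]]
      by (simp add: p_def q_def algebra_simps)
    moreover have "s * (2 * (q / \<mu>) * (- r / (\<mu> + 1) / \<mu>)) = -2 * (q / \<mu>) * (s / (\<mu> * (\<mu> + 1)) * r)"
      using \<mu> by (simp add: field_simps)
    then have eq: "s * (2 * (q / \<mu>) * (- r / (\<mu> + 1) / \<mu>)) = -2 * (q / \<mu>) * (q - p)"
      by (simp only: p_def q_def r_def bessel_series_contiguous[OF \<mu>])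
    have "2 * p * (- q / \<mu>) + ((q / \<mu>)\<^sup>2 + s * (2 * (q / \<mu>) * (- r / (\<mu> + 1) / \<mu>)))
        = (1 - 2 * \<mu>) * (q / \<mu>)\<^sup>2"
      unfolding eq using \<mu> by (simp add: power2_eq_square field_simps)
    ultimately show ?thesis by (simp add: q_def)
  qed
  then have "E s \<le> E 0"
    using assms by (intro DERIV_nonpos_imp_nonincreasing[of 0 s E]) (auto intro!: mult_nonpos_nonneg exI)
  then show ?thesis by (simp add: E_def)
qed

lemma abs_bessel_series_le_1:
  assumes "1 / 2 \<le> \<mu>" "0 \<le> s"
  shows "\<bar>bessel_series \<mu> s\<bar> \<le> 1"
proof -
  have "0 \<le> s * (bessel_series (\<mu> + 1) s / \<mu>)\<^sup>2" using assms by simp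
  then show ?thesis
    using bessel_series_energy[OF assms] abs_square_le_1[of "bessel_series \<mu> s"] by linarith
qed

text \<open>The difference of the two sides vanishes at 0, and its derivative is 1 -
  \<open>bessel_series (\<mu> + 1)\<close>, nonnegative by the energy bound for the parameter \<mu>
  + 1.\<close>

lemma bessel_series_le:
  assumes "1 / 2 \<le> \<mu>" "0 \<le> s"
  shows "\<mu> * (1 - bessel_series \<mu> s) \<le> s"
proof -
  define h where "h s = s - \<mu> * (1 - bessel_series \<mu> s)" for s
  have "(h has_real_derivative 1 - bessel_series (\<mu> + 1) x) (at x)" for x
    unfolding h_def using assms
    by (auto intro!: derivative_eq_intros bessel_series_deriv)
  moreover have "0 \<le> 1 - bessel_series (\<mu> + 1) x" if "0 \<le> x" for x
    using abs_bessel_series_le_1[of "\<mu> + 1" x] assms that by auto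
  ultimately have "h 0 \<le> h s"
    using assms by (intro DERIV_nonneg_imp_nondecreasing[of 0 s h]) blast+
  then show ?thesis by (simp add: h_def)
qed

text \<open>The derivative of \<open>s + s \<Phi>' + (\<mu> - 1) \<Phi>\<close> is \<open>1 - \<Phi>\<close>, where \<open>\<Phi>\<close> is
  \<^term>\<open>bessel_series \<mu>\<close>.\<close>

lemma bessel_series_average:
  assumes "1 / 2 \<le> \<mu>"
  obtains Q where "\<And>s. (Q has_real_derivative 1 - bessel_series \<mu> s) (at s)"
    and "\<And>w. 272 + 16 * \<mu> \<le> w \<Longrightarrow> w / 4 \<le> Q w - Q (w / 2)"
proof -
  have \<mu>: "0 < \<mu>" using assms by simp
  define q where "q s = bessel_series (\<mu> + 1) s / \<mu>" for s
  \<comment> \<open>Here \<open>q\<close> is -\<Phi>'. Bessel's equation reads (s \<Phi>')' + (\<mu>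
    - 1) \<Phi>' + \<Phi> = 0, which gives a primitive of \<Phi>.\<close>
  define Q where "Q s = s - s * q s + (\<mu> - 1) * bessel_series \<mu> s" for s
  have "(Q has_real_derivative 1 - bessel_series \<mu> s) (at s)" for s
  proof -
    have dq: "(q has_real_derivative - bessel_series (\<mu> + 2) s / (\<mu> + 1) / \<mu>) (at s)"
      unfolding q_def using bessel_series_deriv[of "\<mu> + 1" s] \<mu>
      by (intro DERIV_cdivide) (simp add: add.assoc)
    have "(Q has_real_derivative 1 - (q s + s * (- bessel_series (\<mu> + 2) s / (\<mu> + 1) / \<mu>)) + (\<mu> - 1) * (- q s)) (at s)"
      unfolding Q_def
      using DERIV_add[OF DERIV_diff[OF DERIV_ident DERIV_mult[OF DERIV_ident dq]] DERIV_cmult[OF bessel_series_deriv[OF \<mu>], of "\<mu> - 1"]]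
      by (simp add: q_def algebra_simps)
    moreover have "s * (- bessel_series (\<mu> + 2) s / (\<mu> + 1) / \<mu>)
        = - (bessel_series (\<mu> + 1) s - bessel_series \<mu> s)"
      using bessel_series_contiguous[OF \<mu>, of s] by (simp add: mult.commute)
    moreover have "bessel_series (\<mu> + 1) s = \<mu> * q s" using \<mu> by (simp add: q_def)
    ultimately have "(Q has_real_derivative 1 - (q s - (\<mu> * q s - bessel_series \<mu> s)) + (\<mu> - 1) * (- q s)) (at s)"
      by (simp only: diff_conv_add_uminus)
    then show ?thesis by (simp add: algebra_simps)
  qed
  \<comment> \<open>The main term is w/2. The two terms with \<open>q\<close> cost at most 2 sqrt w
    \<le> w/8 once w \<ge> 256, the two with \<mu> - 1 at most 2 (\<mu> + 1) \<le> w/8 once w \<ge>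
    16 (\<mu> + 1); the threshold is the sum of both.\<close>
  moreover have "w / 4 \<le> Q w - Q (w / 2)" if w: "272 + 16 * \<mu> \<le> w" for w
  proof -
    have sq: "\<bar>s * q s\<bar> \<le> sqrt s" if "0 \<le> s" for s
    proof (rule real_le_rsqrt)
      have "s * (q s)\<^sup>2 \<le> 1"
        using bessel_series_energy[OF assms that] zero_le_power2[of "bessel_series \<mu> s"]
        unfolding q_def by linarith
      then have "s * (s * (q s)\<^sup>2) \<le> s * 1" using that by (intro mult_left_mono)
      then show "\<bar>s * q s\<bar>\<^sup>2 \<le> s" by (simp add: power2_eq_square mult_ac)
    qed
    have p: "\<bar>(\<mu> - 1) * bessel_series \<mu> s\<bar> \<le> \<mu> + 1" if "0 \<le> s" for s
    proof -
      have "\<bar>\<mu> - 1\<bar> * \<bar>bessel_series \<mu> s\<bar> \<le> (\<mu> + 1) * 1"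
        using abs_bessel_series_le_1[OF assms that] \<mu> by (intro mult_mono) auto
      then show ?thesis by (simp add: abs_mult)
    qed
    have "0 \<le> w" using w \<mu> by linarith
    have "sqrt (w / 2) \<le> sqrt w" using \<open>0 \<le> w\<close> by simp
    moreover have "16 * sqrt w \<le> sqrt w * sqrt w"
      using w \<mu> by (intro mult_right_mono real_le_rsqrt) auto
    then have "16 * sqrt w \<le> w" using \<open>0 \<le> w\<close> by simp
    ultimately show ?thesis
      using sq[of w] sq[of "w / 2"] p[of w] p[of "w / 2"] w \<open>0 \<le> w\<close>
      unfolding Q_def by linarith
  qed
  ultimately show thesis using that by blast
qed

section \<open>The 2F3 series and its first-order differential equation\<close>

text \<open>For \<open>a > 0\<close> the \<open>2F3\<close> series of the multiplier is \<open>a w\<^sup>-\<^sup>a \<integral>\<^sub>0\<^sup>w s\<^sup>a\<^sup>-\<^sup>1 G(s) ds\<close> with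
  \<open>G(s) = \<mu> (1 - \<Phi>(s)) / s\<close>; the last property below is the differential form of this, valid also
  for \<open>a \<le> 0\<close>.\<close>

lemma hyp2F3_deriv:
  assumes "0 < \<mu>" "-1 < a"
  obtains F' where
    "\<And>w. ((\<lambda>w. hyp2F3 1 a 2 (\<mu> + 1) (a + 1) (- w)) has_real_derivative F' w) (at w)"
    and "F' 0 = - a / ((a + 1) * (2 * (\<mu> + 1)))"
    and "\<And>w. w * (w * F' w + a * hyp2F3 1 a 2 (\<mu> + 1) (a + 1) (- w)) = a * \<mu> * (1 - bessel_series \<mu> w)"
proof -
  define r where "r j = pochhammer a j / pochhammer (a + 1) j" for j
  define g where "g j = (-1) ^ j / (fact (Suc j) * pochhammer (\<mu> + 1) j)" for j :: nat
  define f where "f j = r j * g j" for j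
  define F where "F w = hyp2F3 1 a 2 (\<mu> + 1) (a + 1) (- w)" for w
  have pa: "0 < pochhammer (a + 1) j" for j
    using assms by (intro pochhammer_pos) auto
  have pm: "0 < pochhammer (\<mu> + 1) j" for j
    using assms by (intro pochhammer_pos) auto
  \<comment> \<open>The product form replaces r j = a / (a + j), which fails at a = 0, j = 0: there
    the quotient is 0 by convention, while r 0 = 1.\<close>
  have r: "(a + real j) * r j = a" for j
    using pochhammer_rec[of a j] pochhammer_Suc[of a j] pa[of j]
    by (simp add: r_def field_simps)
  have r_bound: "\<bar>r j\<bar> \<le> 1 + \<bar>a\<bar> / (a + 1)" for j
  proof (cases j)
    case 0
    then show ?thesis using assms by (simp add: r_def)
  next
    case (Suc i)
    have "(a + 1) * \<bar>r j\<bar> \<le> \<bar>a + real j\<bar> * \<bar>r j\<bar>"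
      using assms Suc by (intro mult_right_mono) auto
    also have "\<dots> = \<bar>a\<bar>" by (simp only: r flip: abs_mult)
    finally have "\<bar>r j\<bar> \<le> \<bar>a\<bar> / (a + 1)" using assms by (simp add: field_simps)
    then show ?thesis by simp
  qed
  have sF: "summable (\<lambda>j. f j * w ^ j)" for w
  proof (rule summable_over_pochhammer[where C = "1 + \<bar>a\<bar> / (a + 1)" and \<mu> = "\<mu> + 1"])
    fix j :: nat
    have "\<bar>g j\<bar> \<le> 1 / (fact j * pochhammer (\<mu> + 1) j)"
    proof -
      have "\<bar>g j\<bar> = 1 / (fact (Suc j) * pochhammer (\<mu> + 1) j)"
        using pm[of j] by (simp add: g_def abs_mult abs_of_pos del: fact_Suc)
      also have "\<dots> \<le> 1 / (fact j * pochhammer (\<mu> + 1) j)"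
        using pm[of j]
        by (intro divide_left_mono mult_right_mono fact_mono) (auto simp del: fact_Suc)
      finally show ?thesis .
    qed
    then have "\<bar>f j\<bar> \<le> (1 + \<bar>a\<bar> / (a + 1)) * (1 / (fact j * pochhammer (\<mu> + 1) j))"
      unfolding f_def abs_mult using assms by (intro mult_mono r_bound) auto
    then show "\<bar>f j\<bar> \<le> (1 + \<bar>a\<bar> / (a + 1)) / (fact j * pochhammer (\<mu> + 1) j)" by simp
  qed (use assms in simp)
  have "pochhammer 1 j * pochhammer a j / (pochhammer 2 j * pochhammer (\<mu> + 1) j * pochhammer (a + 1) j) * ((- w) ^ j / fact j)
     = f j * w ^ j" for w j
  proof -
    have "pochhammer 1 j = (fact j :: real)" "pochhammer 2 j = (fact (Suc j) :: real)"
      using pochhammer_rec[of "1::real" j] by (simp_all add: pochhammer_fact)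
    moreover have "(- w) ^ j = (-1) ^ j * w ^ j" by (simp flip: power_mult_distrib)
    ultimately show ?thesis by (simp add: f_def r_def g_def mult_ac del: fact_Suc)
  qed
  then have F: "F w = (\<Sum>j. f j * w ^ j)" for w
    by (simp add: F_def hyp2F3_def)
  define F' where "F' w = (\<Sum>n. diffs f n * w ^ n)" for w
  have F': "(F has_real_derivative F' w) (at w)" for w
    unfolding F[abs_def] F'_def by (intro termdiffs_strong_converges_everywhere sF)
  \<comment> \<open>At w = 0 the differential equation below reads 0 = 0, so this value has to come
    from the series itself.\<close>
  have "F' 0 = f 1"
    unfolding F'_def powser_zero by (simp add: diffs_def)
  then have F'0: "F' 0 = - a / ((a + 1) * (2 * (\<mu> + 1)))"
    by (simp add: f_def r_def g_def)
  \<comment> \<open>In w F' + a F the n-th coefficient is (n + a) r n g n = a g n, so the ratio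
    \<open>r\<close> cancels. The extra factor w shifts what remains into the Bessel series without
    its constant term and avoids dividing by w.\<close>
  have "w * (w * F' w + a * F w) = a * \<mu> * (1 - bessel_series \<mu> w)" for w
  proof -
    have "(\<lambda>n. diffs f n * w ^ n) sums F' w"
      unfolding F'_def by (intro summable_sums termdiff_converges_all sF)
    from sums_mult[OF this, of w]
    have "(\<lambda>n. real (Suc n) * f (Suc n) * w ^ Suc n) sums (w * F' w)"
      by (simp add: diffs_def mult_ac)
    then have "(\<lambda>n. real n * f n * w ^ n) sums (w * F' w)"
      by (rule sums_Suc_imp[rotated]) simp
    moreover have "(\<lambda>n. a * (f n * w ^ n)) sums (a * F w)"
      unfolding F by (intro sums_mult summable_sums sF)
    ultimately have "(\<lambda>n. real n * f n * w ^ n + a * (f n * w ^ n)) sums (w * F' w + a * F w)"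
      by (rule sums_add)
    moreover have "real n * f n * w ^ n + a * (f n * w ^ n) = a * g n * w ^ n" for n
      using arg_cong[OF r[of n], of "\<lambda>x. x * g n * w ^ n"] by (simp add: f_def algebra_simps)
    ultimately have "(\<lambda>n. w * (a * g n * w ^ n)) sums (w * (w * F' w + a * F w))"
      by (intro sums_mult) simp
    moreover have "(\<lambda>n. w * (a * g n * w ^ n)) sums (a * \<mu> * (1 - bessel_series \<mu> w))"
    proof -
      define b where "b n = a * \<mu> * ((-1) ^ n / (fact n * pochhammer \<mu> n) * w ^ n)" for n
      have "b sums (a * \<mu> * bessel_series \<mu> w)"
        unfolding b_def by (intro sums_mult bessel_series_sums assms)
      then have "(\<lambda>n. b (Suc n)) sums (a * \<mu> * bessel_series \<mu> w - a * \<mu>)"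
        by (subst sums_Suc_iff) (simp add: b_def)
      then have "(\<lambda>n. - b (Suc n)) sums (a * \<mu> * (1 - bessel_series \<mu> w))"
        using sums_minus by (fastforce simp: algebra_simps)
      moreover have "- b (Suc n) = w * (a * g n * w ^ n)" for n
        using assms by (simp add: b_def g_def pochhammer_rec del: fact_Suc)
      ultimately show ?thesis by simp
    qed
    ultimately show ?thesis by (rule sums_unique2)
  qed
  with that[of F'] F' F'0 show thesis unfolding F_def by blast
qed

lemma hyp2F3_0 [simp]: "hyp2F3 a1 a2 b1 b2 b3 0 = 1"
  using powser_zero[of "\<lambda>j. pochhammer a1 j * pochhammer a2 j / (pochhammer b1 j * pochhammer b2 j * pochhammer b3 j) / fact j"]
  by (simp add: hyp2F3_def)

lemma hyp2F3_lower_bound: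
  assumes \<mu>: "1 / 2 \<le> \<mu>" and a: "-1 < a"
  obtains c W where "0 < c" "0 < W"
    and "\<And>w. W \<le> w \<Longrightarrow> c * w powr - min 1 a \<le> hyp2F3 1 a 2 (\<mu> + 1) (a + 1) (- w)"
proof -
  define F where "F w = hyp2F3 1 a 2 (\<mu> + 1) (a + 1) (- w)" for w
  define \<Phi> where "\<Phi> = bessel_series \<mu>"
  have "0 < \<mu>" using \<mu> by simp
  from hyp2F3_deriv[OF this a] obtain F' where F': "\<And>w. (F has_real_derivative F' w) (at w)"
    and F'0: "F' 0 = - a / ((a + 1) * (2 * (\<mu> + 1)))"
    and ode: "\<And>w. w * (w * F' w + a * F w) = a * \<mu> * (1 - \<Phi> w)"
    unfolding F_def \<Phi>_def by blast
  have \<Phi>: "\<bar>\<Phi> w\<bar> \<le> 1" "\<mu> * (1 - \<Phi> w) \<le> w" if "0 \<le> w" for w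
    using abs_bessel_series_le_1[OF \<mu> that] bessel_series_le[OF \<mu> that] by (simp_all add: \<Phi>_def)
  have [simp]: "F 0 = 1" by (simp add: F_def)
  \<comment> \<open>The factor w^a removes the homogeneous solution, so the sign of the derivative
    depends only on 1 - \<Phi> and d. The shift d is 0 for a > 0 and F 0 = 1 for a < 0.\<close>
  define P where "P d w = w powr a * (F w - d)" for d w
  have P': "(P d has_real_derivative w powr (a - 2) * (a * (\<mu> * (1 - \<Phi> w) - d * w))) (at w)"
    if "0 < w" for d w
  proof -
    have "(P d has_real_derivative a * w powr (a - 1) * (F w - d) + w powr a * F' w) (at w)"
      unfolding P_def using that
      by (auto intro!: derivative_eq_intros F')
    moreover have "w powr (a - 1) = w powr (a - 2) * w" "w powr a = w powr (a - 2) * (w * w)"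
      using powr_add[of w "a - 2" 1] powr_add[of w "a - 2" 2] that
      by (simp_all add: powr_numeral power2_eq_square)
    then have "a * w powr (a - 1) * (F w - d) + w powr a * F' w
        = w powr (a - 2) * (w * (w * F' w + a * F w) - a * d * w)"
      by (simp add: algebra_simps)
    then have "a * w powr (a - 1) * (F w - d) + w powr a * F' w
        = w powr (a - 2) * (a * (\<mu> * (1 - \<Phi> w) - d * w))"
      unfolding ode by (simp add: algebra_simps)
    ultimately show ?thesis by simp
  qed
  have F_eq: "F w = d + P d w * w powr - a" if "0 < w" for d w
    using that by (simp add: P_def powr_minus field_simps)
  have mono: "P d x \<le> P d y"
    if "0 < x" "x \<le> y" "\<And>w. 0 < w \<Longrightarrow> 0 \<le> a * (\<mu> * (1 - \<Phi> w) - d * w)" for d x y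
  proof (rule DERIV_nonneg_imp_nondecreasing[OF that(2)])
    fix w assume "x \<le> w"
    with that(1) have "0 < w" by linarith
    then show "\<exists>y. (P d has_real_derivative y) (at w) \<and> 0 \<le> y"
      using P'[of w d] mult_nonneg_nonneg[OF powr_ge_zero that(3)[of w]] by blast
  qed
  consider "a = 0" | "a < 0" | "0 < a" by linarith
  then show thesis
  proof cases
    case 1
    have "w * F' w = 0" for w using ode[of w] 1 by auto
    then have "F' w = 0" for w using F'0 1 by (cases "w = 0") auto
    then have "(F has_real_derivative 0) (at w)" for w using F'[of w] by simp
    then have "F w = F 0" for w by (intro DERIV_isconst_all) auto
    with 1 that[of 1 1] show thesis by (simp add: F_def)
  next
    case 2
    \<comment> \<open>F exceeds F 0 = 1 just to the right of 0. From there on \<open>P 1\<close>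
      cannot decrease, being driven by the product of a < 0 and \<mu> (1 - \<Phi>) - w \<le>
      0.\<close>
    have "0 < F' 0" unfolding F'0 using 2 a \<mu> by (intro divide_pos_pos mult_pos_pos) auto
    then obtain e where "0 < e" and e: "\<And>h. 0 < h \<Longrightarrow> h < e \<Longrightarrow> F 0 < F (0 + h)"
      using DERIV_pos_inc_right[OF F'] by blast
    define w0 where "w0 = e / 2"
    have w0: "0 < w0" "0 < P 1 w0" using \<open>0 < e\<close> e[of w0] by (auto simp: w0_def P_def)
    have "P 1 w0 * w powr - min 1 a \<le> F w" if "w0 \<le> w" for w
    proof -
      have "P 1 w0 \<le> P 1 w"
        using w0 that 2 \<Phi> by (intro mono mult_nonpos_nonpos) auto
      then have "P 1 w0 * w powr - a \<le> P 1 w * w powr - a" by (intro mult_right_mono) auto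
      also have "\<dots> \<le> F w" using F_eq[of w 1] w0 that by simp
      finally show ?thesis using 2 by simp
    qed
    with that w0 show thesis unfolding F_def by blast
  next
    case 3
    have nonneg: "0 \<le> a * (\<mu> * (1 - \<Phi> w) - 0 * w)" if "0 < w" for w
      using 3 \<mu> \<Phi>(1)[of w] that by auto
    have "isCont F 0" using F' by (rule DERIV_isCont)
    then have "(F \<longlongrightarrow> 1) (at_right 0)" by (simp add: isCont_def filterlim_at_split)
    then have "eventually (\<lambda>w. 0 < F w) (at_right 0)" by (rule order_tendstoD) simp
    then obtain e where "0 < e" and e: "\<And>h. 0 < h \<Longrightarrow> h < e \<Longrightarrow> 0 < F h"
      by (auto simp: eventually_at_right_field)
    define w0 where "w0 = e / 2"
    have w0: "0 < w0" "0 < P 0 w0" using \<open>0 < e\<close> e[of w0] by (auto simp: w0_def P_def)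
    have P_mono: "P 0 x \<le> P 0 y" if "0 < x" "x \<le> y" for x y
      using mono[OF that nonneg] .
    show thesis
    proof (cases "a \<le> 1")
      case True
      have "P 0 w0 * w powr - min 1 a \<le> F w" if "w0 \<le> w" for w
        using P_mono[OF w0(1) that] F_eq[of w 0] w0 that True
        by (simp add: min_def mult_right_mono)
      with that w0 show thesis unfolding F_def by blast
    next
      case False
      obtain Q where Q': "\<And>s. (Q has_real_derivative 1 - \<Phi> s) (at s)"
        and Q: "\<And>w. 272 + 16 * \<mu> \<le> w \<Longrightarrow> w / 4 \<le> Q w - Q (w / 2)"
        unfolding \<Phi>_def by (rule bessel_series_average[OF \<mu>]) blast
      \<comment> \<open>The summand 2 w0 puts w/2 beyond \<open>w0\<close>; the rest is the
        threshold for \<open>Q\<close>. The constant \<open>c\<close> is read off from K (w/4) = c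
        w^(a-1) with \<open>K\<close> below.\<close>
      define W where "W = 2 * w0 + 272 + 16 * \<mu>"
      define c where "c = a * \<mu> / 4 / 2 powr (a - 1)"
      have "c * w powr - min 1 a \<le> F w" if "W \<le> w" for w
      proof -
        have w: "0 < w" "w0 \<le> w / 2" using that w0 \<mu> by (auto simp: W_def)
        \<comment> \<open>A lower bound for a \<mu> x^(a-2) on [w/2, w]. Writing x^(a-2) as x^(a-1)
          / x and bounding the numerator at the left end, the denominator at the right end, treats a
          < 2 and a \<ge> 2 alike.\<close>
        define K where "K = (w / 2) powr (a - 1) / w * (a * \<mu>)"
        have K: "0 \<le> K" using w 3 \<mu> by (simp add: K_def)
        have "P 0 (w / 2) - K * Q (w / 2) \<le> P 0 w - K * Q w"
        proof (rule DERIV_nonneg_imp_nondecreasing[where f = "\<lambda>x. P 0 x - K * Q x"])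
          fix x assume x: "w / 2 \<le> x" "x \<le> w"
          then have "0 < x" using w by linarith
          have "(w / 2) powr (a - 1) / w \<le> x powr (a - 1) / x"
            using x w False \<open>0 < x\<close> by (intro frac_le powr_mono2) auto
          also have "\<dots> = x powr (a - 2)"
            using powr_diff[of x "a - 1" 1] \<open>0 < x\<close> by simp
          finally have "K \<le> x powr (a - 2) * (a * \<mu>)"
            unfolding K_def using 3 \<mu> by (intro mult_right_mono) auto
          then have "0 \<le> (x powr (a - 2) * (a * \<mu>) - K) * (1 - \<Phi> x)"
            using \<Phi>(1)[of x] \<open>0 < x\<close> by (intro mult_nonneg_nonneg) auto
          moreover have "((\<lambda>x. P 0 x - K * Q x) has_real_derivative (x powr (a - 2) * (a * \<mu>) - K) * (1 - \<Phi> x)) (at x)"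
            using DERIV_diff[OF P'[OF \<open>0 < x\<close>, of 0] DERIV_cmult[OF Q', of K]]
            by (simp add: algebra_simps)
          ultimately show "\<exists>y. ((\<lambda>x. P 0 x - K * Q x) has_real_derivative y) (at x) \<and> 0 \<le> y"
            by blast
        qed (use w in simp)
        moreover have "K * (w / 4) \<le> K * (Q w - Q (w / 2))"
          using that w0 \<mu> K by (intro mult_left_mono Q) (auto simp: W_def)
        moreover have "0 \<le> P 0 (w / 2)" using P_mono[OF w0(1) w(2)] w0 by simp
        ultimately have "K * (w / 4) \<le> P 0 w" by (simp add: algebra_simps)
        then have "K * (w / 4) * w powr - a \<le> F w"
          using F_eq[of w 0] w by (simp add: mult_right_mono)
        also have "K * (w / 4) = c * w powr (a - 1)"
          using w by (simp add: K_def c_def powr_divide mult_ac)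
        also have "c * w powr (a - 1) * w powr - a = c * w powr - 1"
          unfolding mult.assoc by (simp flip: powr_add)
        finally show ?thesis using False by simp
      qed
      moreover have "0 < c" "0 < W" using 3 \<mu> w0 by (auto simp: c_def W_def)
      ultimately show thesis using that unfolding F_def by blast
    qed
  qed
qed

text \<open>As w is proportional to |\<nu>|^2, the bound for F yields the power 2 - 2 min(1,a) of
  |\<nu>|, and 2 - 2 a = \<beta> - n. \<open>R\<close> is the norm at which w reaches the threshold
  \<open>W\<close>.\<close>

lemma multiplier_lower_bound:
  fixes \<delta> \<beta> :: real
  assumes "0 < \<delta>" and "\<beta> < real CARD('n) + 4"
  obtains c R where "0 < c" "0 < R"
    and "\<And>\<nu> :: real ^ 'n::finite. R \<le> norm \<nu> \<Longrightarrow>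
      c * norm \<nu> powr max 0 (\<beta> - real CARD('n)) \<le> \<bar>multiplier \<delta> \<beta> \<nu>\<bar>"
proof -
  define a where "a = (real CARD('n) + 2 - \<beta>) / 2"
  define \<mu> where "\<mu> = real CARD('n) / 2"
  have "1 \<le> CARD('n)" by simp
  then have "1 / 2 \<le> \<mu>" by (simp add: \<mu>_def)
  moreover have "-1 < a" using assms by (simp add: a_def)
  ultimately obtain c W where cW: "0 < c" "0 < W"
    and F: "\<And>w. W \<le> w \<Longrightarrow> c * w powr - min 1 a \<le> hyp2F3 1 a 2 (\<mu> + 1) (a + 1) (- w)"
    by (rule hyp2F3_lower_bound) blast
  define c' where "c' = c * (\<delta>\<^sup>2 / 4) powr - min 1 a"
  define R where "R = sqrt (W / (\<delta>\<^sup>2 / 4))"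
  have "c' * norm \<nu> powr max 0 (\<beta> - real CARD('n)) \<le> \<bar>multiplier \<delta> \<beta> \<nu>\<bar>"
    if "R \<le> norm \<nu>" for \<nu> :: "real ^ 'n"
  proof -
    define w where "w = (norm \<nu>)\<^sup>2 * (\<delta>\<^sup>2 / 4)"
    have "0 < R" using cW assms by (simp add: R_def)
    then have \<nu>: "0 < norm \<nu>" using that by linarith
    have "R\<^sup>2 \<le> (norm \<nu>)\<^sup>2" using that \<open>0 < R\<close> by (intro power_mono) auto
    moreover have "R\<^sup>2 = W / (\<delta>\<^sup>2 / 4)" using cW assms unfolding R_def by (intro real_sqrt_pow2) simp
    ultimately have "W \<le> w" using assms by (simp add: w_def field_simps)
    then have "(norm \<nu>)\<^sup>2 * (c * w powr - min 1 a)
        \<le> (norm \<nu>)\<^sup>2 * hyp2F3 1 a 2 (\<mu> + 1) (a + 1) (- w)"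
      by (intro mult_left_mono F) auto
    also have "\<dots> = - multiplier \<delta> \<beta> \<nu>"
      by (simp add: multiplier_def a_def \<mu>_def w_def field_simps)
    also have "\<dots> \<le> \<bar>multiplier \<delta> \<beta> \<nu>\<bar>" by simp
    finally have "(norm \<nu>)\<^sup>2 * (c * w powr - min 1 a) \<le> \<bar>multiplier \<delta> \<beta> \<nu>\<bar>" .
    moreover have "w powr - min 1 a = (\<delta>\<^sup>2 / 4) powr - min 1 a * norm \<nu> powr (- 2 * min 1 a)"
      using \<nu> powr_powr[of "norm \<nu>" 2 "- min 1 a"]
      by (simp add: w_def powr_mult powr_numeral mult.commute del: times_divide_eq_right times_divide_eq_left)
    then have "(norm \<nu>)\<^sup>2 * (c * w powr - min 1 a)
        = c' * ((norm \<nu>)\<^sup>2 * norm \<nu> powr (- 2 * min 1 a))"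
      by (simp add: c'_def mult_ac)
    moreover have "(norm \<nu>)\<^sup>2 * norm \<nu> powr (- 2 * min 1 a)
        = norm \<nu> powr (2 + (- 2 * min 1 a))"
      using \<nu> unfolding powr_add by (simp add: powr_numeral)
    moreover have "2 + (- 2 * min 1 a) = max 0 (\<beta> - real CARD('n))"
      by (simp add: a_def min_def max_def field_simps)
    ultimately show ?thesis by simp
  qed
  moreover have "0 < c'" "0 < R" using cW assms by (auto simp: c'_def R_def)
  ultimately show thesis using that by blast
qed

section \<open>Test functions and trigonometric modes on the torus\<close>

lemma real_vec_nth [simp]: "real_vec k $ i = real_of_int (k $ i)"
  by (simp add: real_vec_def)

lemma real_vec_0 [simp]: "real_vec 0 = 0"
  by (simp add: vec_eq_iff)

lemma real_vec_eq_0_iff [simp]: "real_vec k = 0 \<longleftrightarrow> k = 0"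
  by (simp add: vec_eq_iff)

lemma real_vec_add: "real_vec (k + l) = real_vec k + real_vec l"
  by (simp add: vec_eq_iff)

section \<open>Periodic functions and their integrals over the torus\<close>

lemma periodic_translate:
  assumes "periodic f"
  shows "f (x + (2 * pi) *\<^sub>R real_vec k) = f x"
proof -
  have nat: "f (x + (2 * pi * real n) *\<^sub>R axis i 1) = f x" for i n x
  proof (induction n)
    case (Suc n)
    have "f (x + (2 * pi * real (Suc n)) *\<^sub>R axis i 1)
        = f ((x + (2 * pi * real n) *\<^sub>R axis i 1) + (2 * pi) *\<^sub>R axis i 1)"
      by (simp add: algebra_simps)
    also have "\<dots> = f x" using assms Suc by (simp add: periodic_def)
    finally show ?case .
  qed simp
  have int: "f (x + (2 * pi * real_of_int j) *\<^sub>R axis i 1) = f x" for i j x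
  proof (cases j)
    case (nonneg n)
    then show ?thesis using nat by simp
  next
    case (neg n)
    then have "real_of_int j = - real (Suc n)" by simp
    then have "x + (2 * pi * real_of_int j) *\<^sub>R axis i 1 + (2 * pi * real (Suc n)) *\<^sub>R axis i 1 = x"
      by (simp del: of_nat_Suc)
    then show ?thesis
      using nat[of "x + (2 * pi * real_of_int j) *\<^sub>R axis i 1" "Suc n" i] by metis
  qed
  have "f (x + (\<Sum>i\<in>S. (2 * pi * real_of_int (k $ i)) *\<^sub>R axis i 1)) = f x" for S
  proof (induction S rule: infinite_finite_induct)
    case (insert i S)
    then show ?case
      using int[of "x + (\<Sum>i\<in>S. (2 * pi * real_of_int (k $ i)) *\<^sub>R axis i 1)" "k $ i" i]
      by (simp add: algebra_simps)
  qed auto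
  moreover have "(\<Sum>i\<in>UNIV. (2 * pi * real_of_int (k $ i)) *\<^sub>R axis i 1) = (2 * pi) *\<^sub>R real_vec k"
    by (simp add: vec_eq_iff axis_def if_distrib cong: if_cong)
  ultimately show ?thesis by metis
qed

lemma periodic_continuous_bounded:
  assumes "periodic f" "continuous_on UNIV f"
  obtains B where "\<And>x. cmod (f x) \<le> B"
proof -
  have "bounded (f ` torus)"
    unfolding torus_def
    by (intro compact_imp_bounded compact_continuous_image continuous_on_subset[OF assms(2)]) auto
  then obtain B where B: "\<And>x. x \<in> torus \<Longrightarrow> cmod (f x) \<le> B"
    by (auto simp: bounded_iff)
  have "cmod (f x) \<le> B" for x
  proof -
    define k where "k = (\<chi> i. - \<lfloor>x $ i / (2 * pi)\<rfloor>)"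
    have "x + (2 * pi) *\<^sub>R real_vec k \<in> torus"
    proof -
      have "0 \<le> x $ i + 2 * pi * real_of_int (k $ i) \<and> x $ i + 2 * pi * real_of_int (k $ i) \<le> 2 * pi" for i
      proof -
        define y where "y = x $ i / (2 * pi)"
        have "x $ i = 2 * pi * y" by (simp add: y_def)
        moreover have "k $ i = - \<lfloor>y\<rfloor>" by (simp add: k_def y_def)
        ultimately have "x $ i + 2 * pi * real_of_int (k $ i) = 2 * pi * frac y"
          by (simp add: frac_def algebra_simps)
        then show ?thesis using frac_ge_0[of y] frac_lt_1[of y] by (simp add: mult_left_le)
      qed
      then show ?thesis by (simp add: torus_def mem_box_cart)
    qed
    then show ?thesis using B periodic_translate[OF assms(1), of x k] by metis
  qed
  with that show thesis by blast
qed

lemma integral_cbox_translate: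
  fixes f :: "'a::euclidean_space \<Rightarrow> 'b::banach"
  assumes "continuous_on UNIV f"
  shows "integral (cbox a b) (\<lambda>x. f (x + c)) = integral (cbox (a + c) (b + c)) f"
proof -
  have "f integrable_on cbox (a + c) (b + c)"
    by (intro integrable_continuous continuous_on_subset[OF assms]) auto
  from has_integral_affinity'[OF integrable_integral[OF this], of 1 c]
  show ?thesis by (simp add: integral_unique)
qed

lemma integral_cbox_split:
  fixes f :: "real ^ 'n::finite \<Rightarrow> 'b::banach"
  assumes "continuous_on UNIV f" "a $ i \<le> c" "c \<le> b $ i"
  shows "integral (cbox a b) f = integral (cbox a (\<chi> j. if j = i then c else b $ j)) f
    + integral (cbox (\<chi> j. if j = i then c else a $ j) b) f"
proof (rule integral_unique)
  have int: "f integrable_on cbox u v" for u v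
    by (intro integrable_continuous continuous_on_subset[OF assms(1)]) auto
  have 1: "cbox a b \<inter> {x. x \<bullet> axis i 1 \<le> c} = cbox a (\<chi> j. if j = i then c else b $ j)"
    using interval_split_cart(1)[where a = a and b = b and c = c and k = i] assms(3)
    by (simp add: inner_axis cbox_interval cong: if_cong)
  have 2: "cbox a b \<inter> {x. c \<le> x \<bullet> axis i 1} = cbox (\<chi> j. if j = i then c else a $ j) b"
    using interval_split_cart(2)[where a = a and b = b and c = c and k = i] assms(2)
    by (simp add: inner_axis cbox_interval cong: if_cong)
  show "(f has_integral (integral (cbox a (\<chi> j. if j = i then c else b $ j)) f
    + integral (cbox (\<chi> j. if j = i then c else a $ j) b) f)) (cbox a b)"
    by (rule has_integral_split[of f _ a b "axis i 1" c])
      (auto simp: 1 2 axis_in_Basis_iff intro!: integrable_integral int)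
qed

text \<open>The shifted cube is cut at the face x_i = 2 pi; the part sticking out, moved back by one
  period, fills the gap left where x_i < h.\<close>

lemma integral_torus_translate:
  fixes f :: "real ^ 'n::finite \<Rightarrow> complex"
  assumes f: "periodic f" "continuous_on UNIV f" and h: "0 \<le> h" "h \<le> 2 * pi"
  shows "integral torus (\<lambda>x. f (x + h *\<^sub>R axis i 1)) = integral torus f"
proof -
  define b :: "real ^ 'n" where "b = (\<chi> i. 2 * pi)"
  define e :: "real ^ 'n" where "e = axis i 1"
  have e: "e $ j = (if j = i then 1 else 0)" for j by (simp add: e_def axis_def)
  have "integral torus (\<lambda>x. f (x + h *\<^sub>R e)) = integral (cbox (h *\<^sub>R e) (b + h *\<^sub>R e)) f"
    using integral_cbox_translate[OF f(2)] by (simp add: torus_def b_def)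
  also have "\<dots> = integral (cbox (h *\<^sub>R e) (\<chi> j. if j = i then 2 * pi else (b + h *\<^sub>R e) $ j)) f
      + integral (cbox (\<chi> j. if j = i then 2 * pi else (h *\<^sub>R e) $ j) (b + h *\<^sub>R e)) f"
    by (intro integral_cbox_split f) (use h in \<open>auto simp: b_def e\<close>)
  also have "(\<chi> j. if j = i then 2 * pi else (b + h *\<^sub>R e) $ j) = b"
    by (simp add: vec_eq_iff b_def e)
  also have "(\<chi> j. if j = i then 2 * pi else (h *\<^sub>R e) $ j) = 0 + (2 * pi) *\<^sub>R e"
    by (simp add: vec_eq_iff e)
  also have "b + h *\<^sub>R e = (\<chi> j. if j = i then h else b $ j) + (2 * pi) *\<^sub>R e"
    by (simp add: vec_eq_iff b_def e)
  also have "integral (cbox (0 + (2 * pi) *\<^sub>R e) ((\<chi> j. if j = i then h else b $ j) + (2 * pi) *\<^sub>R e)) f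
      = integral (cbox 0 (\<chi> j. if j = i then h else b $ j)) f"
    unfolding integral_cbox_translate[OF f(2), symmetric]
    using f(1) by (simp add: periodic_def e_def)
  also have "integral (cbox (h *\<^sub>R e) b) f + integral (cbox 0 (\<chi> j. if j = i then h else b $ j)) f
      = integral (cbox 0 b) f"
  proof -
    have "h *\<^sub>R e = (\<chi> j. if j = i then h else 0 $ j)"
      by (simp add: vec_eq_iff e)
    then show ?thesis
      using integral_cbox_split[OF f(2), of 0 i h b] h by (simp add: b_def)
  qed
  finally show ?thesis by (simp add: torus_def b_def e_def)
qed

text \<open>The integral of f(x + t e_i) is constant for t in [0, 2 pi], and differentiating under
  the integral sign at t = 0, from the right, gives the integral of \<open>f'\<close>. Applied to
  products this is integration by parts without boundary terms.\<close>

lemma integral_torus_partial_eq_0: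
  fixes f :: "real ^ 'n::finite \<Rightarrow> complex"
  assumes f: "periodic f" "continuous_on UNIV f" and f': "continuous_on UNIV f'"
    and deriv: "\<And>x. ((\<lambda>h. f (x + h *\<^sub>R axis i 1)) has_vector_derivative f' x) (at 0)"
  shows "integral torus f' = 0"
proof -
  let ?e = "axis i 1 :: real ^ 'n"
  have deriv_t: "((\<lambda>h. f (x + h *\<^sub>R ?e)) has_vector_derivative f' (x + t *\<^sub>R ?e)) (at t)" for x t
  proof -
    have "((\<lambda>h. h - t) has_vector_derivative 1) (at t)"
      by (auto intro!: derivative_eq_intros)
    from vector_diff_chain_at[OF this, of "\<lambda>h. f (x + t *\<^sub>R ?e + h *\<^sub>R ?e)"] deriv[of "x + t *\<^sub>R ?e"]
    show ?thesis by (simp add: o_def algebra_simps)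
  qed
  have cont: "continuous_on S (\<lambda>x. f (x + t *\<^sub>R ?e))" for S t
    by (rule continuous_on_compose2[OF f(2)]) (auto intro!: continuous_intros)
  have "((\<lambda>t. integral torus (\<lambda>x. f (x + t *\<^sub>R ?e))) has_vector_derivative
      integral torus (\<lambda>x. f' (x + 0 *\<^sub>R ?e))) (at 0 within {0..2 * pi})"
    unfolding torus_def
  proof (rule leibniz_rule_vector_derivative)
    show "continuous_on ({0..2 * pi} \<times> cbox 0 (\<chi> i. 2 * pi)) (\<lambda>(t, x). f' (x + t *\<^sub>R ?e))"
      unfolding split_beta
      by (rule continuous_on_compose2[OF f']) (auto intro!: continuous_intros)
    show "(\<lambda>x. f (x + t *\<^sub>R ?e)) integrable_on cbox 0 (\<chi> i. 2 * pi)" for t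
      by (intro integrable_continuous cont)
    show "((\<lambda>t. f (x + t *\<^sub>R ?e)) has_vector_derivative f' (x + t *\<^sub>R ?e)) (at t within {0..2 * pi})" for t x
      using deriv_t by (rule has_vector_derivative_at_within)
  qed auto
  then have "((\<lambda>t. integral torus (\<lambda>x. f (x + t *\<^sub>R ?e))) has_vector_derivative integral torus f')
      (at 0 within {0..2 * pi})" by simp
  then have "((\<lambda>t. integral torus f) has_vector_derivative integral torus f') (at 0 within {0..2 * pi})"
    by (rule has_vector_derivative_transform[rotated 2]) (auto simp: integral_torus_translate[OF f])
  moreover have "((\<lambda>t. integral torus f) has_vector_derivative 0) (at 0 within {0..2 * pi})"
    by simp
  moreover have "at (0::real) within {0..2 * pi} \<noteq> bot"
    by (simp add: at_within_Icc_at_right)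
  ultimately show ?thesis by (metis vector_derivative_unique_within)
qed

section \<open>Trigonometric modes\<close>

lemma mode_0: "mode 0 = (\<lambda>x. 1)"
  by (simp add: mode_def fun_eq_iff)

lemma mode_mult: "mode k x * mode l x = mode (k + l) x"
  by (simp add: mode_def real_vec_add inner_add_left algebra_simps flip: exp_add)

lemma norm_mode [simp]: "cmod (mode k x) = 1"
  by (simp add: mode_def)

lemma continuous_on_mode [continuous_intros]: "continuous_on S (mode k)"
  unfolding mode_def[abs_def] by (intro continuous_intros)

lemma periodic_mode: "periodic (mode k)"
proof -
  have "mode k (x + (2 * pi) *\<^sub>R axis i 1) = mode k x" for x :: "real ^ 'a" and i
  proof -
    have "exp (\<i> * of_real (2 * pi * real_of_int (k $ i))) = (1::complex)"
      using exp_integer_2pi[of "of_int (k $ i)"] by (simp add: mult_ac)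
    then show ?thesis
      by (simp add: mode_def inner_add_right inner_axis exp_add distrib_left)
  qed
  then show ?thesis by (simp add: periodic_def)
qed

lemma mode_deriv:
  "((\<lambda>h. mode k (x + h *\<^sub>R axis i 1)) has_vector_derivative (\<i> * of_int (k $ i)) * mode k x) (at 0)"
  unfolding mode_def inner_add_right inner_scaleR_right inner_axis
  by (auto intro!: derivative_eq_intros has_vector_derivative_real_field simp: algebra_simps)

lemma content_torus: "measure lborel (torus :: (real ^ 'n::finite) set) = (2 * pi) ^ CARD('n)"
  unfolding torus_def by (subst content_cbox_cart) (auto simp: interval_eq_empty_cart)

text \<open>For k \<noteq> 0 some k_i is nonzero, and \<open>mode k\<close> times i k_i is a partial
  derivative of a periodic function, so its integral vanishes.\<close>

lemma integral_mode:
  "integral torus (mode k :: real ^ 'n::finite \<Rightarrow> complex)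
    = (if k = 0 then of_real ((2 * pi) ^ CARD('n)) else 0)"
proof (cases "k = 0")
  case True
  have "integral torus (\<lambda>x :: real ^ 'n. 1 :: complex) = of_real (measure lborel (torus :: (real ^ 'n) set))"
    unfolding torus_def by (simp add: scaleR_conv_of_real)
  then show ?thesis using True by (simp add: mode_0 content_torus)
next
  case False
  then obtain i where i: "k $ i \<noteq> 0" by (auto simp: vec_eq_iff)
  have "integral torus (\<lambda>x. (\<i> * of_int (k $ i)) * mode k x) = 0"
    by (rule integral_torus_partial_eq_0[OF periodic_mode _ _ mode_deriv]) (intro continuous_intros)+
  then show ?thesis using i False by simp
qed

lemma dist_of_mode_mode:
  "dist_of (mode k) (mode (- l) :: real ^ 'n::finite \<Rightarrow> complex)
    = (if k = l then of_real ((2 * pi) ^ CARD('n)) else 0)"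
  unfolding dist_of_def mode_mult integral_mode by simp

section \<open>Test functions and the decay of their Fourier coefficients\<close>

lemma partials_append: "partials (is @ js) \<phi> = partials is (partials js \<phi>)"
  by (simp add: partials_def)

lemma smooth_partials: "smooth \<phi> \<Longrightarrow> smooth (partials is \<phi>)"
  unfolding smooth_def by (metis partials_append)

lemma smooth_continuous: "smooth \<phi> \<Longrightarrow> continuous_on UNIV \<phi>"
  unfolding smooth_def partials_def by (metis foldr_Nil id_apply)

lemma smooth_deriv:
  "smooth \<phi> \<Longrightarrow> ((\<lambda>h. \<phi> (x + h *\<^sub>R axis i 1)) has_vector_derivative partial i \<phi> x) (at 0)"
  unfolding partial_def vector_derivative_works[symmetric] smooth_def partials_def
  by (metis foldr_Nil id_apply)

lemma periodic_partials: "periodic \<phi> \<Longrightarrow> periodic (partials is \<phi>)"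
proof (induction "is")
  case (Cons i "is")
  then have "partials is \<phi> ((x + (2 * pi) *\<^sub>R axis j 1) + h *\<^sub>R axis i 1) = partials is \<phi> (x + h *\<^sub>R axis i 1)" for x j h
    unfolding periodic_def by (metis add.assoc add.commute)
  then show ?case
    by (simp add: periodic_def partials_def partial_def)
qed (simp add: partials_def)

lemma test_function_partials: "\<phi> \<in> test_functions \<Longrightarrow> partials is \<phi> \<in> test_functions"
  by (simp add: test_functions_def smooth_partials periodic_partials)

lemma cmod_partials_le_test_norm:
  fixes \<phi> :: "real ^ 'n::finite \<Rightarrow> complex"
  assumes "\<phi> \<in> test_functions" "length is \<le> N"
  shows "cmod (partials is \<phi> x) \<le> test_norm N \<phi>"
proof -
  have "bdd_above ((\<lambda>(is, x). cmod (partials is \<phi> x)) ` ({is. length is \<le> N} \<times> UNIV))"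
  proof -
    have "bdd_above (\<Union>is\<in>{is. length is \<le> N}. range (\<lambda>x. cmod (partials is \<phi> x)))"
    proof (subst bdd_above_UN, goal_cases)
      case 1
      then show ?case using finite_lists_length_le[of "UNIV :: 'n set" N] by simp
    next
      case 2
      show ?case
      proof
        fix js
        obtain B where "\<And>x. cmod (partials js \<phi> x) \<le> B"
          using test_function_partials[OF assms(1), of js] periodic_continuous_bounded smooth_continuous
          by (auto simp: test_functions_def)
        then show "bdd_above (range (\<lambda>x. cmod (partials js \<phi> x)))" by (intro bdd_aboveI[where M = B]) auto
      qed
    qed
    then show ?thesis by (rule bdd_above_mono) auto
  qed
  from cSUP_upper[OF _ this, of "(is, x)"] show ?thesis
    using assms(2) by (simp add: test_norm_def)
qed

lemma dist_of_mode_partial: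
  assumes "\<phi> \<in> test_functions"
  shows "dist_of (mode k) (partial i \<phi>) = - (\<i> * of_int (k $ i)) * dist_of (mode k) \<phi>"
proof -
  have \<phi>: "smooth \<phi>" "periodic \<phi>" using assms by (auto simp: test_functions_def)
  have c: "continuous_on S \<phi>" "continuous_on S (partial i \<phi>)" for S
    using smooth_continuous[OF \<phi>(1)] smooth_continuous[OF smooth_partials[OF \<phi>(1)], of "[i]"]
    by (auto simp: partials_def intro: continuous_on_subset)
  have "integral torus (\<lambda>x. mode k x * partial i \<phi> x + (\<i> * of_int (k $ i)) * (mode k x * \<phi> x)) = 0"
  proof (rule integral_torus_partial_eq_0)
    show "periodic (\<lambda>x. mode k x * \<phi> x)"
      using periodic_mode[of k] \<phi>(2) by (simp add: periodic_def)
    show "((\<lambda>h. mode k (x + h *\<^sub>R axis i 1) * \<phi> (x + h *\<^sub>R axis i 1)) has_vector_derivative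
        mode k x * partial i \<phi> x + (\<i> * of_int (k $ i)) * (mode k x * \<phi> x)) (at 0)" for x
      using has_vector_derivative_mult[OF mode_deriv smooth_deriv[OF \<phi>(1)], of k x i x i] by (simp add: mult.assoc)
  qed (intro continuous_intros c)+
  moreover have "(\<lambda>x. mode k x * partial i \<phi> x) integrable_on torus"
    "(\<lambda>x. (\<i> * of_int (k $ i)) * (mode k x * \<phi> x)) integrable_on torus"
    unfolding torus_def by (intro integrable_continuous continuous_intros c)+
  ultimately show ?thesis
    by (simp add: dist_of_def integral_add add_eq_0_iff2)
qed

lemma norm_dist_of_mode_le:
  fixes \<phi> :: "real ^ 'n::finite \<Rightarrow> complex"
  assumes "\<phi> \<in> test_functions"
  shows "cmod (dist_of (mode k) \<phi>) \<le> (2 * pi) ^ CARD('n) * test_norm N \<phi>"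
proof -
  have le: "cmod (\<phi> x) \<le> test_norm N \<phi>" for x
    using cmod_partials_le_test_norm[OF assms, of "[]" N x] by (simp add: partials_def)
  have "continuous_on UNIV \<phi>" using assms by (simp add: test_functions_def smooth_continuous)
  then have "(\<lambda>x. mode k x * \<phi> x) integrable_on torus"
    unfolding torus_def by (intro integrable_continuous continuous_intros) (auto intro: continuous_on_subset)
  from has_integral_bound[OF _ integrable_integral[OF this[unfolded torus_def]], of "test_norm N \<phi>"]
  have "cmod (dist_of (mode k) \<phi>) \<le> test_norm N \<phi> * measure lborel (torus :: (real ^ 'n) set)"
    using le order_trans[OF norm_ge_zero le] by (simp add: dist_of_def norm_mult torus_def)
  then show ?thesis by (simp add: content_torus mult.commute)
qed

text \<open>All derivatives are taken in one direction i, chosen from k such that |k| \<le> n |k_i|.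
  Then 1 + |k|^2 \<le> 2 n^2 k_i^2 for k \<noteq> 0, whence the constant (2 n^2)^M and the 2 M
  derivatives.\<close>

lemma dist_of_mode_decay:
  fixes k :: "int ^ 'n::finite"
  assumes "\<phi> \<in> test_functions"
  shows "(1 + (norm (real_vec k))\<^sup>2) ^ M * cmod (dist_of (mode k) \<phi>)
    \<le> (2 * (real CARD('n))\<^sup>2) ^ M * (2 * pi) ^ CARD('n) * test_norm (2 * M) \<phi>"
proof -
  have "\<bar>real_of_int (k $ i)\<bar> ^ N * cmod (dist_of (mode k) \<phi>) \<le> (2 * pi) ^ CARD('n) * test_norm N \<phi>" for i N
  proof -
    have "dist_of (mode k) (partials (replicate m i) \<phi>) = (- (\<i> * of_int (k $ i))) ^ m * dist_of (mode k) \<phi>" for m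
    proof (induction m)
      case (Suc m)
      have "partials (replicate (Suc m) i) \<phi> = partial i (partials (replicate m i) \<phi>)"
        by (simp add: partials_def)
      then show ?case
        using dist_of_mode_partial[OF test_function_partials[OF assms], of k i "replicate m i"] Suc
        by (simp add: mult_ac)
    qed (simp add: partials_def)
    from arg_cong[OF this[of N], of cmod]
    have "\<bar>real_of_int (k $ i)\<bar> ^ N * cmod (dist_of (mode k) \<phi>) = cmod (dist_of (mode k) (partials (replicate N i) \<phi>))"
      by (simp add: norm_mult norm_power)
    also have "\<dots> \<le> (2 * pi) ^ CARD('n) * test_norm 0 (partials (replicate N i) \<phi>)"
      by (intro norm_dist_of_mode_le test_function_partials assms)
    also have "test_norm 0 (partials (replicate N i) \<phi>) \<le> test_norm N \<phi>"
      unfolding test_norm_def[of 0]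
    proof (rule cSUP_least)
      fix p :: "'n list \<times> (real ^ 'n)" assume "p \<in> {is. length is \<le> 0} \<times> UNIV"
      then show "(case p of (is, x) \<Rightarrow> cmod (partials is (partials (replicate N i) \<phi>) x)) \<le> test_norm N \<phi>"
        using cmod_partials_le_test_norm[OF assms, of "replicate N i" N] by (auto simp: partials_def)
    qed auto
    finally show ?thesis by (simp add: mult_left_mono)
  qed
  note coord = this
  define n where "n = real CARD('n)"
  have "1 \<le> n" by (simp add: n_def Suc_le_eq)
  show ?thesis
  proof (cases "k = 0")
    case True
    have "1 \<le> (2 * n\<^sup>2) ^ M"
      using one_le_power[OF \<open>1 \<le> n\<close>, of 2] by (intro one_le_power) linarith
    moreover have "0 \<le> (2 * pi) ^ CARD('n) * test_norm (2 * M) \<phi>"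
      using order_trans[OF norm_ge_zero norm_dist_of_mode_le[OF assms]] .
    ultimately have "1 * ((2 * pi) ^ CARD('n) * test_norm (2 * M) \<phi>)
        \<le> (2 * n\<^sup>2) ^ M * ((2 * pi) ^ CARD('n) * test_norm (2 * M) \<phi>)"
      by (rule mult_right_mono)
    then have "cmod (dist_of (mode k) \<phi>) \<le> (2 * n\<^sup>2) ^ M * ((2 * pi) ^ CARD('n) * test_norm (2 * M) \<phi>)"
      using norm_dist_of_mode_le[OF assms, of k "2 * M"] by (simp only: mult_1)
    then show ?thesis
      using True by (simp add: n_def mult.assoc)
  next
    case False
    have "\<exists>i. norm (real_vec k) \<le> n * \<bar>real_of_int (k $ i)\<bar>"
    proof (rule ccontr)
      assume "\<not> ?thesis"
      then have "\<bar>real_of_int (k $ i)\<bar> < norm (real_vec k) / n" for i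
        using \<open>1 \<le> n\<close> by (simp add: not_le field_simps)
      then have "(\<Sum>i\<in>UNIV. \<bar>real_of_int (k $ i)\<bar>) < (\<Sum>i\<in>(UNIV :: 'n set). norm (real_vec k) / n)"
        by (intro sum_strict_mono) auto
      also have "\<dots> = norm (real_vec k)" using \<open>1 \<le> n\<close> by (simp add: n_def)
      finally show False using norm_le_l1_cart[of "real_vec k"] by simp
    qed
    then obtain i where i: "norm (real_vec k) \<le> n * \<bar>real_of_int (k $ i)\<bar>" by blast
    have "k $ i \<noteq> 0" using i False by (auto simp: norm_le_zero_iff)
    then have "1 \<le> \<bar>real_of_int (k $ i)\<bar>" by linarith
    then have "1 * 1 \<le> n * \<bar>real_of_int (k $ i)\<bar>" using \<open>1 \<le> n\<close> by (intro mult_mono) auto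
    then have "1 \<le> (n * \<bar>real_of_int (k $ i)\<bar>)\<^sup>2" by (intro one_le_power) simp
    moreover have "(norm (real_vec k))\<^sup>2 \<le> (n * \<bar>real_of_int (k $ i)\<bar>)\<^sup>2"
      using i by (intro power_mono) auto
    ultimately have "1 + (norm (real_vec k))\<^sup>2 \<le> 2 * n\<^sup>2 * \<bar>real_of_int (k $ i)\<bar>\<^sup>2"
      unfolding power_mult_distrib by linarith
    then have "(1 + (norm (real_vec k))\<^sup>2) ^ M \<le> (2 * n\<^sup>2 * \<bar>real_of_int (k $ i)\<bar>\<^sup>2) ^ M"
      by (intro power_mono) auto
    also have "\<dots> = (2 * n\<^sup>2) ^ M * \<bar>real_of_int (k $ i)\<bar> ^ (2 * M)"
      by (simp only: power_mult_distrib power_mult)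
    finally have "(1 + (norm (real_vec k))\<^sup>2) ^ M * cmod (dist_of (mode k) \<phi>)
      \<le> (2 * n\<^sup>2) ^ M * \<bar>real_of_int (k $ i)\<bar> ^ (2 * M) * cmod (dist_of (mode k) \<phi>)"
      by (rule mult_right_mono) simp
    also have "\<dots> \<le> (2 * n\<^sup>2) ^ M * ((2 * pi) ^ CARD('n) * test_norm (2 * M) \<phi>)"
      unfolding mult.assoc by (intro mult_left_mono coord) auto
    finally show ?thesis by (simp add: n_def mult.assoc)
  qed
qed

section \<open>Fourier series in Sobolev spaces\<close>

lemma summable_on_int_inverse_square: "(\<lambda>j. 1 / (1 + (real_of_int j)\<^sup>2)) summable_on UNIV"
proof -
  have nat: "(\<lambda>n. 1 / (1 + (real n)\<^sup>2)) summable_on UNIV"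
  proof (rule norm_summable_imp_summable_on, rule summable_comparison_test)
    show "summable (\<lambda>n. 1 / (real n)\<^sup>2)"
      using inverse_power_summable[of 2, where ?'a = real] by (simp add: inverse_eq_divide)
    show "\<exists>N. \<forall>n\<ge>N. norm (norm (1 / (1 + (real n)\<^sup>2))) \<le> 1 / (real n)\<^sup>2"
      by (intro exI[of _ 1] allI impI) (auto intro!: divide_left_mono simp: add_pos_nonneg)
  qed
  have "(\<lambda>j. 1 / (1 + (real_of_int j)\<^sup>2)) summable_on range int"
    using nat by (subst summable_on_reindex) (auto simp: o_def)
  moreover have "(\<lambda>j. 1 / (1 + (real_of_int j)\<^sup>2)) summable_on (\<lambda>n. - int n) ` {0<..}"
    using summable_on_subset_banach[OF nat, of "{0<..}"]
    by (subst summable_on_reindex) (auto simp: o_def inj_on_def)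
  moreover have "range int \<inter> (\<lambda>n. - int n) ` {0<..} = {}" by auto
  moreover have "range int \<union> (\<lambda>n. - int n) ` {0<..} = UNIV"
  proof -
    have "j \<in> range int \<union> (\<lambda>n. - int n) ` {0<..}" for j
    proof (cases j)
      case (neg n)
      then show ?thesis by (intro UnI2 image_eqI[of _ _ "Suc n"]) auto
    qed auto
    then show ?thesis by blast
  qed
  ultimately show ?thesis by (metis summable_on_Un_disjoint)
qed

text \<open>Each 1 + k_i^2 is at most 1 + |k|^2, and the exponent supplies one factor per
  coordinate, so the terms are dominated by products of terms of a convergent one-dimensional
  series.\<close>

lemma summable_on_lattice:
  "(\<lambda>k :: int ^ 'n::finite. 1 / (1 + (norm (real_vec k))\<^sup>2) ^ CARD('n)) summable_on UNIV"
proof (rule nonneg_bdd_above_summable_on)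
  define g where "g j = 1 / (1 + (real_of_int j)\<^sup>2)" for j :: int
  have g: "0 \<le> g j" for j by (simp add: g_def)
  have le: "1 / (1 + (norm (real_vec k))\<^sup>2) ^ CARD('n) \<le> (\<Prod>i\<in>UNIV. g (k $ i))" for k :: "int ^ 'n"
  proof -
    have "(\<Prod>i\<in>UNIV. 1 + (real_of_int (k $ i))\<^sup>2) \<le> (\<Prod>i\<in>(UNIV :: 'n set). 1 + (norm (real_vec k))\<^sup>2)"
    proof (rule prod_mono)
      fix i
      have "\<bar>real_of_int (k $ i)\<bar>\<^sup>2 \<le> (norm (real_vec k))\<^sup>2"
        using component_le_norm_cart[of "real_vec k" i] by (intro power_mono) auto
      then show "0 \<le> 1 + (real_of_int (k $ i))\<^sup>2 \<and> 1 + (real_of_int (k $ i))\<^sup>2 \<le> 1 + (norm (real_vec k))\<^sup>2"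
        by simp
    qed
    then have "1 / (1 + (norm (real_vec k))\<^sup>2) ^ CARD('n) \<le> 1 / (\<Prod>i\<in>UNIV. 1 + (real_of_int (k $ i))\<^sup>2)"
      by (intro divide_left_mono mult_pos_pos prod_pos) (auto intro!: zero_less_power simp: add_pos_nonneg)
    then show ?thesis by (simp add: g_def prod_dividef)
  qed
  show "bdd_above (sum (\<lambda>k :: int ^ 'n. 1 / (1 + (norm (real_vec k))\<^sup>2) ^ CARD('n)) ` {F. F \<subseteq> UNIV \<and> finite F})"
  proof (rule bdd_aboveI2)
    fix F :: "(int ^ 'n) set" assume "F \<in> {F. F \<subseteq> UNIV \<and> finite F}"
    then have "finite F" by simp
    \<comment> \<open>\<open>T\<close> collects all coordinates of points of \<open>F\<close>. Over
      the full box with sides \<open>T\<close> the sum of products factors into a product of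
      sums.\<close>
    define T where "T = (\<Union>i. (\<lambda>k. k $ i) ` F)"
    have "finite T" using \<open>finite F\<close> by (simp add: T_def)
    have "inj_on vec_nth F" by (simp add: inj_on_def vec_nth_inject)
    have "(\<Sum>k\<in>F. 1 / (1 + (norm (real_vec k))\<^sup>2) ^ CARD('n)) \<le> (\<Sum>k\<in>F. \<Prod>i\<in>UNIV. g (k $ i))"
      by (intro sum_mono le)
    also have "\<dots> = (\<Sum>p\<in>vec_nth ` F. \<Prod>i\<in>UNIV. g (p i))"
      using \<open>inj_on vec_nth F\<close> by (simp add: sum.reindex)
    also have "\<dots> \<le> (\<Sum>p\<in>Pi\<^sub>E (UNIV :: 'n set) (\<lambda>_. T). \<Prod>i\<in>UNIV. g (p i))"
      using \<open>finite T\<close> by (intro sum_mono2 finite_PiE prod_nonneg g) (auto simp: T_def)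
    also have "\<dots> = (\<Prod>i\<in>(UNIV :: 'n set). \<Sum>j\<in>T. g j)"
      using \<open>finite T\<close> by (intro prod_sum_PiE[symmetric]) auto
    also have "\<dots> \<le> (\<Prod>i\<in>(UNIV :: 'n set). infsum g UNIV)"
      using \<open>finite T\<close> summable_on_int_inverse_square
      by (intro prod_mono conjI sum_nonneg g finite_sum_le_infsum) (auto simp: g_def[abs_def])
    finally show "(\<Sum>k\<in>F. 1 / (1 + (norm (real_vec k))\<^sup>2) ^ CARD('n)) \<le> (\<Prod>i\<in>(UNIV :: 'n set). infsum g UNIV)" .
  qed
qed simp

lemma finite_lattice_ball: "finite {k :: int ^ 'n::finite. norm (real_vec k) < R}"
proof (rule finite_subset)
  have "\<bar>real_of_int (k $ i)\<bar> < R" if "norm (real_vec k) < R" for k :: "int ^ 'n" and i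
    using component_le_norm_cart[of "real_vec k" i] that by simp
  then have "k $ i \<in> {- \<lceil>R\<rceil>..\<lceil>R\<rceil>}" if "norm (real_vec k) < R" for k :: "int ^ 'n" and i
    using that[THEN \<open>\<And>k i. norm (real_vec k) < R \<Longrightarrow> \<bar>real_of_int (k $ i)\<bar> < R\<close>, of i] by simp linarith
  then show "{k :: int ^ 'n. norm (real_vec k) < R} \<subseteq> vec_lambda ` (Pi\<^sub>E UNIV (\<lambda>_. {- \<lceil>R\<rceil>..\<lceil>R\<rceil>}))"
    by (auto intro!: image_eqI[of _ vec_lambda "vec_nth _"] simp: PiE_iff)
  show "finite (vec_lambda ` (Pi\<^sub>E UNIV (\<lambda>_. {- \<lceil>R\<rceil>..\<lceil>R\<rceil>})) :: (int ^ 'n) set)"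
    by (intro finite_imageI finite_PiE) auto
qed

section \<open>From square-summable weighted coefficients to distributions\<close>

text \<open>A single term is at most the whole sum. Such a crude bound suffices because pairing with
  a test function gains every power of |k|.\<close>

lemma weighted_coeff_bound:
  fixes c :: "int ^ 'n::finite \<Rightarrow> complex"
  assumes "(\<lambda>k. (1 + (norm (real_vec k))\<^sup>2) powr q * (cmod (c k))\<^sup>2) summable_on UNIV"
  obtains A where "\<And>k. cmod (c k) \<le> A * (1 + (norm (real_vec k))\<^sup>2) powr (- q / 2)"
proof -
  define S where "S = (\<Sum>\<^sub>\<infinity>k. (1 + (norm (real_vec k))\<^sup>2) powr q * (cmod (c k))\<^sup>2)"
  have "cmod (c k) \<le> sqrt S * (1 + (norm (real_vec k))\<^sup>2) powr (- q / 2)" for k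
  proof -
    define w where "w = 1 + (norm (real_vec k))\<^sup>2"
    have "0 < w" by (simp add: w_def add_pos_nonneg)
    have "w powr q * (cmod (c k))\<^sup>2 \<le> S"
      using finite_sum_le_infsum[OF assms, of "{k}"] by (simp add: S_def w_def)
    moreover have "w powr q = (w powr (q / 2))\<^sup>2"
      using \<open>0 < w\<close> by (simp add: powr_powr flip: powr_numeral)
    ultimately have "(w powr (q / 2) * cmod (c k))\<^sup>2 \<le> S" by (simp add: power_mult_distrib)
    then have "w powr (q / 2) * cmod (c k) \<le> sqrt S" by (rule real_le_rsqrt)
    then show ?thesis
      using \<open>0 < w\<close> by (simp add: powr_minus field_simps flip: w_def)
  qed
  with that show thesis by blast
qed

text \<open>The constants are independent of \<phi>: the second claim is the continuity estimate
  required of a periodic distribution.\<close>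

lemma summable_fourier_pairing:
  fixes c :: "int ^ 'n::finite \<Rightarrow> complex"
  assumes "(\<lambda>k. (1 + (norm (real_vec k))\<^sup>2) powr q * (cmod (c k))\<^sup>2) summable_on UNIV"
  obtains K N where
    "\<And>\<phi>. \<phi> \<in> test_functions \<Longrightarrow> (\<lambda>k. cmod (c k * dist_of (mode k) \<phi>)) summable_on UNIV"
    and "\<And>\<phi>. \<phi> \<in> test_functions \<Longrightarrow> (\<Sum>\<^sub>\<infinity>k. cmod (c k * dist_of (mode k) \<phi>)) \<le> K * test_norm N \<phi>"
proof -
  obtain A where A: "\<And>k. cmod (c k) \<le> A * (1 + (norm (real_vec k))\<^sup>2) powr (- q / 2)"
    using weighted_coeff_bound[OF assms] by blast
  have "0 \<le> A" using order_trans[OF norm_ge_zero A[of 0]] by simp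
  \<comment> \<open>The first summand pays for summability over the lattice; the second absorbs the
    coefficients, which grow at most like (1 + |k|^2)^(-q/2).\<close>
  define M where "M = CARD('n) + nat \<lceil>\<bar>q\<bar>\<rceil>"
  define B where "B = (2 * (real CARD('n))\<^sup>2) ^ M * (2 * pi) ^ CARD('n)"
  define v where "v k = 1 / (1 + (norm (real_vec k))\<^sup>2) ^ CARD('n)" for k :: "int ^ 'n"
  have v: "v summable_on UNIV" unfolding v_def[abs_def] by (rule summable_on_lattice)
  have le: "cmod (c k * dist_of (mode k) \<phi>) \<le> A * B * test_norm (2 * M) \<phi> * v k"
    if \<phi>: "\<phi> \<in> test_functions" for \<phi> k
  proof -
    define w where "w = 1 + (norm (real_vec k))\<^sup>2"
    have "1 \<le> w" by (simp add: w_def)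
    have decay: "w ^ M * cmod (dist_of (mode k) \<phi>) \<le> B * test_norm (2 * M) \<phi>"
      using dist_of_mode_decay[OF \<phi>, of k M] by (simp add: w_def B_def)
    have "w ^ CARD('n) * w powr (- q / 2) = w powr (real CARD('n) + (- q / 2))"
      using \<open>1 \<le> w\<close> by (simp add: powr_add powr_realpow del: add_uminus_conv_diff)
    also have "\<dots> \<le> w powr real M"
    proof (rule powr_mono)
      have "- q / 2 \<le> real (nat \<lceil>\<bar>q\<bar>\<rceil>)" by linarith
      then show "real CARD('n) + (- q / 2) \<le> real M" by (simp add: M_def)
    qed (use \<open>1 \<le> w\<close> in simp)
    also have "\<dots> = w ^ M" using \<open>1 \<le> w\<close> by (simp add: powr_realpow)
    finally have *: "w ^ CARD('n) * w powr (- q / 2) \<le> w ^ M" .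
    have "w ^ CARD('n) * cmod (c k * dist_of (mode k) \<phi>)
        \<le> w ^ CARD('n) * ((A * w powr (- q / 2)) * cmod (dist_of (mode k) \<phi>))"
      unfolding norm_mult using A[of k] \<open>1 \<le> w\<close>
      by (intro mult_left_mono mult_right_mono) (auto simp: w_def)
    also have "\<dots> = A * ((w ^ CARD('n) * w powr (- q / 2)) * cmod (dist_of (mode k) \<phi>))"
      by (simp add: mult_ac)
    also have "\<dots> \<le> A * (w ^ M * cmod (dist_of (mode k) \<phi>))"
      by (intro mult_left_mono[OF _ \<open>0 \<le> A\<close>] mult_right_mono[OF *]) simp
    also have "\<dots> \<le> A * (B * test_norm (2 * M) \<phi>)"
      by (intro mult_left_mono decay \<open>0 \<le> A\<close>)
    finally show ?thesis
      using \<open>1 \<le> w\<close> by (simp add: v_def field_simps flip: w_def)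
  qed
  have summ: "(\<lambda>k. A * B * test_norm (2 * M) \<phi> * v k) summable_on UNIV" for \<phi> :: "real ^ 'n \<Rightarrow> complex"
    by (intro summable_on_cmult_right v)
  have abs: "(\<lambda>k. cmod (c k * dist_of (mode k) \<phi>)) summable_on UNIV" if "\<phi> \<in> test_functions" for \<phi>
    by (rule summable_on_comparison_test[OF summ]) (auto intro: le[OF that])
  have "(\<Sum>\<^sub>\<infinity>k. cmod (c k * dist_of (mode k) \<phi>)) \<le> (A * B * infsum v UNIV) * test_norm (2 * M) \<phi>"
    if "\<phi> \<in> test_functions" for \<phi>
  proof -
    have "(\<Sum>\<^sub>\<infinity>k. cmod (c k * dist_of (mode k) \<phi>)) \<le> (\<Sum>\<^sub>\<infinity>k. A * B * test_norm (2 * M) \<phi> * v k)"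
      by (intro infsum_mono abs summ le that)
    also have "\<dots> = A * B * test_norm (2 * M) \<phi> * infsum v UNIV"
      by (intro infsum_cmult_right v)
    finally show ?thesis by (simp add: mult_ac)
  qed
  with abs that show thesis by blast
qed

text \<open>The constant mode is split off as in the definition of \<^const>\<open>U\<close>: off the test functions the
  sum may diverge, and then the two ways of summing differ.\<close>

lemma fourier_series_in_sobolev:
  fixes c :: "int ^ 'n::finite \<Rightarrow> complex"
  assumes c: "(\<lambda>k. (1 + (norm (real_vec k))\<^sup>2) powr q * (cmod (c k))\<^sup>2) summable_on UNIV"
  shows "(\<lambda>\<phi>. c 0 * dist_of (mode 0) \<phi> + (\<Sum>\<^sub>\<infinity>k\<in>{k. k \<noteq> 0}. c k * dist_of (mode k) \<phi>)) \<in> sobolev q"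
    (is "?g \<in> _")
proof -
  obtain K N where
    abs: "\<And>\<phi>. \<phi> \<in> test_functions \<Longrightarrow> (\<lambda>k. cmod (c k * dist_of (mode k) \<phi>)) summable_on UNIV"
    and bound: "\<And>\<phi>. \<phi> \<in> test_functions \<Longrightarrow> (\<Sum>\<^sub>\<infinity>k. cmod (c k * dist_of (mode k) \<phi>)) \<le> K * test_norm N \<phi>"
    using summable_fourier_pairing[OF c] by blast
  have summ: "(\<lambda>k. c k * dist_of (mode k) \<phi>) summable_on S" if "\<phi> \<in> test_functions" for \<phi> S
    using summable_on_subset_banach[OF abs_summable_summable[OF abs[OF that]], of S] by simp
  have cont: "continuous_on S \<phi>" if "\<phi> \<in> test_functions" for \<phi> :: "real ^ 'n \<Rightarrow> complex" and S
    using smooth_continuous that by (auto simp: test_functions_def intro: continuous_on_subset)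
  have add: "?g (\<lambda>x. \<phi> x + \<psi> x) = ?g \<phi> + ?g \<psi>"
    if "\<phi> \<in> test_functions" "\<psi> \<in> test_functions" for \<phi> \<psi>
  proof -
    have "dist_of (mode k) (\<lambda>x. \<phi> x + \<psi> x) = dist_of (mode k) \<phi> + dist_of (mode k) \<psi>" for k
      unfolding dist_of_def distrib_left torus_def
      by (intro integral_add integrable_continuous continuous_intros cont that)
    then show ?thesis
      using infsum_add[OF summ[OF that(1)] summ[OF that(2)]] by (simp add: distrib_left)
  qed
  \<comment> \<open>This holds for every \<phi>, since a constant factor can be taken out of
    \<open>infsum\<close> and \<open>integral\<close> even where they take their default value
    0.\<close>
  have scale: "?g (\<lambda>x. a * \<phi> x) = a * ?g \<phi>" for a \<phi>
  proof -
    have "dist_of (mode k) (\<lambda>x. a * \<phi> x) = a * dist_of (mode k) \<phi>" for k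
      unfolding dist_of_def by (simp add: mult.left_commute)
    then show ?thesis
      by (simp add: mult.left_commute[of _ a] infsum_cmult_right' distrib_left)
  qed
  have "cmod (?g \<phi>) \<le> K * test_norm N \<phi>" if \<phi>: "\<phi> \<in> test_functions" for \<phi>
  proof -
    have "?g \<phi> = (\<Sum>\<^sub>\<infinity>k\<in>{0} \<union> {k. k \<noteq> 0}. c k * dist_of (mode k) \<phi>)"
      by (subst infsum_Un_disjoint) (auto intro: summ \<phi>)
    also have "{0} \<union> {k. k \<noteq> 0} = (UNIV :: (int ^ 'n) set)" by auto
    finally have "cmod (?g \<phi>) \<le> (\<Sum>\<^sub>\<infinity>k. cmod (c k * dist_of (mode k) \<phi>))"
      using norm_infsum_bound[OF abs[OF \<phi>]] by simp
    with bound[OF \<phi>] show ?thesis by linarith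
  qed
  then have "periodic_distribution ?g"
    unfolding periodic_distribution_def using add scale by blast
  moreover have "fourier_coeff ?g k = c k" for k
  proof -
    \<comment> \<open>Orthogonality leaves only l = k. For k = 0 the set \<open>{k} - {0}\<close> is
      empty, and the coefficient comes from the separate constant term.\<close>
    have "(\<Sum>\<^sub>\<infinity>l\<in>{l. l \<noteq> 0}. c l * dist_of (mode l) (mode (- k)))
        = (\<Sum>\<^sub>\<infinity>l\<in>{k} - {0}. c l * dist_of (mode l) (mode (- k)))"
      by (rule infsum_cong_neutral) (auto simp: dist_of_mode_mode)
    then have "?g (mode (- k)) = c k * of_real ((2 * pi) ^ CARD('n))"
      unfolding dist_of_mode_mode by (cases "k = 0") auto
    then show ?thesis by (simp add: fourier_coeff_def)
  qed
  ultimately show ?thesis using c by (simp add: sobolev_def)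
qed

section \<open>The coefficients of \<open>U\<close>\<close>

text \<open>With p the exponent of the weight, (1 + |k|^2)^p is of order |k|^(2 p), the square of
  the lower bound for |m|; this is exactly a gain of p derivatives.\<close>

lemma U_coeff_bound:
  fixes b :: "(real ^ 'n::finite \<Rightarrow> complex) \<Rightarrow> complex"
  assumes "0 < \<delta>" and "\<beta> < real CARD('n) + 4"
  obtains C R where "\<And>k. R \<le> norm (real_vec k) \<Longrightarrow>
    (1 + (norm (real_vec k))\<^sup>2) powr max 0 (\<beta> - real CARD('n)) * (cmod (U_coeff \<delta> \<beta> b t k))\<^sup>2
      \<le> C * (cmod (fourier_coeff b k))\<^sup>2"
proof -
  define p where "p = max 0 (\<beta> - real CARD('n))"
  obtain c R0 where c: "0 < c" "0 < R0"
    and m_ge: "\<And>\<nu> :: real ^ 'n. R0 \<le> norm \<nu> \<Longrightarrow> c * norm \<nu> powr p \<le> \<bar>multiplier \<delta> \<beta> \<nu>\<bar>"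
    unfolding p_def using multiplier_lower_bound[OF assms] by blast
  \<comment> \<open>The threshold 1 gives 1 + r^2 \<le> 2 r^2 and so the factor
    \<open>2 powr p\<close>; \<open>R0\<close> gives the bound on m. The 4 is the square of |cos -
    1| \<le> 2.\<close>
  have "(1 + (norm (real_vec k))\<^sup>2) powr p * (cmod (U_coeff \<delta> \<beta> b t k))\<^sup>2
      \<le> (4 * 2 powr p / c\<^sup>2) * (cmod (fourier_coeff b k))\<^sup>2"
    if k: "max 1 R0 \<le> norm (real_vec k)" for k
  proof -
    define r where "r = norm (real_vec k)"
    define m where "m = multiplier \<delta> \<beta> (real_vec k)"
    have "1 \<le> r" using k by (simp add: r_def)
    then have "1 \<le> r\<^sup>2" by simp
    have m: "c * r powr p \<le> \<bar>m\<bar>" using m_ge[of "real_vec k"] k by (simp add: r_def m_def)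
    have "0 < c * r powr p" using c \<open>1 \<le> r\<close> by simp
    \<comment> \<open>The function \<open>sqrt\<close> is total and real-valued, so this bound holds
      whatever the sign of -m.\<close>
    have "\<bar>cos (sqrt (- m) * t) - 1\<bar> \<le> 2"
      using cos_le_one[of "sqrt (- m) * t"] cos_ge_minus_one[of "sqrt (- m) * t"] by linarith
    then have "cmod (U_coeff \<delta> \<beta> b t k) \<le> cmod (fourier_coeff b k) / (c * r powr p) * 2"
      unfolding U_coeff_def Let_def m_def[symmetric] norm_mult norm_divide norm_of_real
      using m \<open>0 < c * r powr p\<close> by (intro mult_mono divide_left_mono) (auto intro!: mult_pos_pos)
    then have "(cmod (U_coeff \<delta> \<beta> b t k))\<^sup>2 \<le> (cmod (fourier_coeff b k) / (c * r powr p) * 2)\<^sup>2"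
      by (intro power_mono) auto
    moreover have "(1 + r\<^sup>2) powr p \<le> (2 * r\<^sup>2) powr p"
      using \<open>1 \<le> r\<^sup>2\<close> by (intro powr_mono2) (auto simp: p_def)
    moreover have "(2 * r\<^sup>2) powr p = 2 powr p * (r powr p)\<^sup>2"
      using \<open>1 \<le> r\<close> powr_powr[of r 2 p] powr_powr[of r p 2]
      by (simp add: powr_mult powr_numeral mult.commute)
    ultimately have "(1 + r\<^sup>2) powr p * (cmod (U_coeff \<delta> \<beta> b t k))\<^sup>2
        \<le> 2 powr p * (r powr p)\<^sup>2 * (cmod (fourier_coeff b k) / (c * r powr p) * 2)\<^sup>2"
      by (intro mult_mono) auto
    also have "\<dots> = (4 * 2 powr p / c\<^sup>2) * (cmod (fourier_coeff b k))\<^sup>2"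
      using \<open>1 \<le> r\<close> c by (simp add: power_mult_distrib power_divide)
    finally show ?thesis by (simp add: r_def)
  qed
  with that show thesis unfolding p_def by blast
qed

theorem theorem15:
  fixes b :: "(real ^ 'n::finite \<Rightarrow> complex) \<Rightarrow> complex" and \<delta> \<beta> \<sigma> :: real
  assumes "\<delta> > 0" and "\<beta> < real CARD('n) + 4" and "b \<in> sobolev \<sigma>"
  shows "\<forall>t\<ge>0. U_converges \<delta> \<beta> b t \<and>
                U \<delta> \<beta> b t \<in> sobolev (\<sigma> + max 0 (\<beta> - real CARD('n)))"
proof (intro allI impI conjI)
  fix t :: real
  define p where "p = max 0 (\<beta> - real CARD('n))"
  define c where "c k = (if k = 0 then fourier_coeff b 0 * of_real (t\<^sup>2 / 2) else U_coeff \<delta> \<beta> b t k)" for k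
  obtain C R where CR: "\<And>k. R \<le> norm (real_vec k) \<Longrightarrow>
      (1 + (norm (real_vec k))\<^sup>2) powr p * (cmod (U_coeff \<delta> \<beta> b t k))\<^sup>2 \<le> C * (cmod (fourier_coeff b k))\<^sup>2"
    unfolding p_def using U_coeff_bound[OF assms(1,2)] by blast
  \<comment> \<open>The finitely many modes of \<open>F\<close> cannot affect summability, whatever
    their values. The mode 0 is inserted explicitly because \<open>c 0\<close> is not given by
    \<open>U_coeff\<close> and nothing forces R > 0.\<close>
  define F where "F = insert 0 {k :: int ^ 'n. norm (real_vec k) < R}"
  have "finite F" using finite_lattice_ball by (simp add: F_def)
  have "(\<lambda>k. (1 + (norm (real_vec k))\<^sup>2) powr \<sigma> * (cmod (fourier_coeff b k))\<^sup>2) summable_on UNIV"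
    using assms(3) by (simp add: sobolev_def)
  then have b: "(\<lambda>k. C * ((1 + (norm (real_vec k))\<^sup>2) powr \<sigma> * (cmod (fourier_coeff b k))\<^sup>2)) summable_on - F"
    by (intro summable_on_cmult_right) (rule summable_on_subset_banach, auto)
  have "(\<lambda>k. (1 + (norm (real_vec k))\<^sup>2) powr (\<sigma> + p) * (cmod (c k))\<^sup>2) summable_on - F"
  proof (rule summable_on_comparison_test[OF b])
    fix k assume "k \<in> - F"
    then have k: "k \<noteq> 0" "R \<le> norm (real_vec k)" by (auto simp: F_def)
    from mult_left_mono[OF CR[OF k(2)], of "(1 + (norm (real_vec k))\<^sup>2) powr \<sigma>"]
    show "(1 + (norm (real_vec k))\<^sup>2) powr (\<sigma> + p) * (cmod (c k))\<^sup>2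
        \<le> C * ((1 + (norm (real_vec k))\<^sup>2) powr \<sigma> * (cmod (fourier_coeff b k))\<^sup>2)"
      using k by (simp add: c_def powr_add mult_ac)
  qed simp
  then have "(\<lambda>k. (1 + (norm (real_vec k))\<^sup>2) powr (\<sigma> + p) * (cmod (c k))\<^sup>2) summable_on (- F \<union> F)"
    using \<open>finite F\<close> by (intro summable_on_Un_disjoint) auto
  then have c: "(\<lambda>k. (1 + (norm (real_vec k))\<^sup>2) powr (\<sigma> + p) * (cmod (c k))\<^sup>2) summable_on UNIV"
    by simp
  show "U_converges \<delta> \<beta> b t"
    unfolding U_converges_def
  proof
    fix \<phi> :: "real ^ 'n \<Rightarrow> complex" assume "\<phi> \<in> test_functions"
    with summable_fourier_pairing[OF c]
    have "(\<lambda>k. c k * dist_of (mode k) \<phi>) summable_on UNIV" by (metis abs_summable_summable)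
    then have "(\<lambda>k. c k * dist_of (mode k) \<phi>) summable_on {k. k \<noteq> 0}"
      by (rule summable_on_subset_banach) simp
    then show "(\<lambda>k. U_coeff \<delta> \<beta> b t k * dist_of (mode k) \<phi>) summable_on {k. k \<noteq> 0}"
      by (rule summable_on_cong[THEN iffD1, rotated]) (simp add: c_def)
  qed
  have "U \<delta> \<beta> b t = (\<lambda>\<phi>. c 0 * dist_of (mode 0) \<phi> + (\<Sum>\<^sub>\<infinity>k\<in>{k. k \<noteq> 0}. c k * dist_of (mode k) \<phi>))"
    by (intro ext) (auto simp: U_def c_def mode_0 intro!: infsum_cong)
  with fourier_series_in_sobolev[OF c]
  show "U \<delta> \<beta> b t \<in> sobolev (\<sigma> + max 0 (\<beta> - real CARD('n)))" by (simp add: p_def)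
qed

end
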